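(* Let $\mathbb{F}_q$ be a finite field of characteristic $>3$. Let $N_{a,b}$ be the number of $\overline{\mathbb{F}}_q$-isomorphism classes of general Jacobi quartic curves $E_{a,b}: y^2=x^4+ax^2+b$ with $a,b\in\mathbb{F}_q$ and $(a^2-4b)b\neq 0$ (that is, the number of classes into which the set of all such curves, as $(a,b)$ varies, is partitioned by isomorphism over $\overline{\mathbb{F}}_q$). Then $$N_{a,b}=\begin{cases} \dfrac{4q+2}{6}, & \text{if } q\equiv 1,7 \pmod{12},\\[2ex] \dfrac{4q-2}{6}, & \text{if } q\equiv 5,11 \pmod{12}.\end{cases}$$
   Context: $\mathbb{F}_q$ is the finite field with $q$ elements and $\overline{\mathbb{F}}_q$ its algebraic closure. A general Jacobi quartic curve over $\mathbb{F}_q$ is $E_{a,b}: y^2=x^4+ax^2+b$ with $a,b\in\mathbb{F}_q$, $(a^2-4b)b\neq 0$. It is regarded as an elliptic curve, i.e. through the smooth projective genus one curve birational to it; it is birationally equivalent to the Weierstrass curve $v^2=u(u^2-2au+a^2-4b)$. Its $j$-invariant is that of this Weierstrass curve, namely $j(E_{a,b})=\frac{16(a^2+12b)^3}{b(a^2-4b)^2}$. Two such curves are isomorphic over $\overline{\mathbb{F}}_q$ if the corresponding elliptic curves are isomorphic over $\overline{\mathbb{F}}_q$, equivalently if they have the same $j$-invariant; thus the number of isomorphism classes is the number of distinct $j$-invariants. *)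

theory Defs
  imports
    "HOL-Library.Cardinality"
    "HOL-Number_Theory.Cong"
    "HOL-Algebra.Algebraic_Closure_Type"
begin

text \<open>
  A point of the projective plane over a field is represented by the set of all its homogeneous
  coordinate triples. Projective curves are sets of such points; they are only meant to be used
  over an algebraically closed field, so that a curve is determined by its points.
\<close>

definition proj_point :: "'k::field \<times> 'k \<times> 'k \<Rightarrow> ('k \<times> 'k \<times> 'k) set" where
  "proj_point = (\<lambda>(x, y, z). {(c * x, c * y, c * z) | c. c \<noteq> 0})"

text \<open>
  Homogeneous polynomials (forms) of degree \<open>d\<close> in three variables, as polynomial functions;
  over an infinite field this loses nothing.
\<close>

definition is_form :: "nat \<Rightarrow> ('k::field \<times> 'k \<times> 'k \<Rightarrow> 'k) \<Rightarrow> bool" where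
  "is_form d F \<longleftrightarrow> (\<exists>c :: nat \<Rightarrow> nat \<Rightarrow> 'k. \<forall>x y z.
     F (x, y, z) = (\<Sum>i\<le>d. \<Sum>j\<le>d - i. c i j * x ^ i * y ^ j * z ^ (d - i - j)))"

text \<open>
  Morphisms between plane projective curves: near every point \<open>P\<close> of \<open>C\<close> the map is given by a
  triple of forms of equal degree. The neighbourhood of \<open>P\<close> is the Zariski open subset of \<open>C\<close>
  on which the three forms do not vanish simultaneously. This is the usual local condition: if
  the map is given by \<open>F1, F2, F3\<close> only where some further form \<open>G\<close> with \<open>G P \<noteq> 0\<close>
  does not vanish, then \<open>G F1, G F2, G F3\<close> represent it in the sense below.
\<close>

definition curve_morphism ::
  "('k::field \<times> 'k \<times> 'k) set set \<Rightarrow> ('k \<times> 'k \<times> 'k) set set \<Rightarrow>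
   (('k \<times> 'k \<times> 'k) set \<Rightarrow> ('k \<times> 'k \<times> 'k) set) \<Rightarrow> bool" where
  "curve_morphism C D \<phi> \<longleftrightarrow>
     (\<forall>P\<in>C. \<phi> P \<in> D) \<and>
     (\<forall>P\<in>C. \<exists>d F1 F2 F3.
        is_form d F1 \<and> is_form d F2 \<and> is_form d F3 \<and>
        (\<exists>p. p \<noteq> (0, 0, 0) \<and> proj_point p = P \<and> (F1 p, F2 p, F3 p) \<noteq> (0, 0, 0)) \<and>
        (\<forall>p. p \<noteq> (0, 0, 0) \<and> proj_point p \<in> C \<and> (F1 p, F2 p, F3 p) \<noteq> (0, 0, 0) \<longrightarrow>
             \<phi> (proj_point p) = proj_point (F1 p, F2 p, F3 p)))"

text \<open>
  The projective closure of \<open>v\<^sup>2 = u (u\<^sup>2 + A u + B)\<close>. Its only point at infinity is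
  \<open>(0 : 1 : 0)\<close>, the neutral element of the group law.
\<close>

definition weierstrass_curve :: "'k::field \<Rightarrow> 'k \<Rightarrow> ('k \<times> 'k \<times> 'k) set set" where
  "weierstrass_curve A B =
     {proj_point (u, v, w) | u v w.
        (u, v, w) \<noteq> (0, 0, 0) \<and> v\<^sup>2 * w = u * (u\<^sup>2 + A * u * w + B * w\<^sup>2)}"

definition point_O :: "('k::field \<times> 'k \<times> 'k) set" where
  "point_O = proj_point (0, 1, 0)"

text \<open>
  Isomorphism of elliptic curves: an isomorphism of varieties that respects the base points.
\<close>

definition elliptic_isomorphic ::
  "('k::field \<times> 'k \<times> 'k) set set \<Rightarrow> ('k \<times> 'k \<times> 'k) set set \<Rightarrow> bool" where
  "elliptic_isomorphic E E' \<longleftrightarrow>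
     (\<exists>\<phi> \<psi>. curve_morphism E E' \<phi> \<and> curve_morphism E' E \<psi> \<and>
        (\<forall>P\<in>E. \<psi> (\<phi> P) = P) \<and> (\<forall>P\<in>E'. \<phi> (\<psi> P) = P) \<and> \<phi> point_O = point_O)"

definition jacobi_quartic :: "'k::field \<Rightarrow> 'k \<Rightarrow> ('k \<times> 'k) set" where
  "jacobi_quartic a b = {(x, y). y\<^sup>2 = x ^ 4 + a * x\<^sup>2 + b}"

text \<open>
  The elliptic curve belonging to \<open>y\<^sup>2 = x\<^sup>4 + a x\<^sup>2 + b\<close>, i.e. its smooth projective model
  \<open>v\<^sup>2 = u (u\<^sup>2 - 2 a u + a\<^sup>2 - 4 b)\<close>.
\<close>

definition jacobi_elliptic :: "'k::field \<Rightarrow> 'k \<Rightarrow> ('k \<times> 'k \<times> 'k) set set" where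
  "jacobi_elliptic a b = weierstrass_curve (- 2 * a) (a\<^sup>2 - 4 * b)"

lemma proj_point_affine_in_weierstrass_curve:
  "proj_point (u, v, 1) \<in> weierstrass_curve A B \<longleftrightarrow> v\<^sup>2 = u * (u\<^sup>2 + A * u + B)"
proof
  assume "proj_point (u, v, 1) \<in> weierstrass_curve A B"
  then obtain u' v' w' where eq: "proj_point (u, v, 1) = proj_point (u', v', w')"
    and cu: "v'\<^sup>2 * w' = u' * (u'\<^sup>2 + A * u' * w' + B * w'\<^sup>2)"
    by (auto simp: weierstrass_curve_def)
  have "(u', v', w') \<in> proj_point (u', v', w')"
    by (auto simp: proj_point_def intro!: exI[of _ 1])
  then have "(u', v', w') \<in> proj_point (u, v, 1)" using eq by simp
  then obtain c where c: "c \<noteq> 0" "u' = c * u" "v' = c * v" "w' = c"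
    by (auto simp: proj_point_def)
  have "c ^ 3 * v\<^sup>2 = c ^ 3 * (u * (u\<^sup>2 + A * u + B))"
    using cu unfolding c(2-4) by (simp add: algebra_simps power2_eq_square power3_eq_cube)
  then show "v\<^sup>2 = u * (u\<^sup>2 + A * u + B)" using c(1) by simp
next
  assume h: "v\<^sup>2 = u * (u\<^sup>2 + A * u + B)"
  show "proj_point (u, v, 1) \<in> weierstrass_curve A B"
    unfolding weierstrass_curve_def using h
    by (intro CollectI exI[of _ u] exI[of _ v] exI[of _ 1]) auto
qed

text \<open>
  The birational correspondence between the quartic and its smooth model. The points of the model
  that are not reached, \<open>(0, 0)\<close> and the point at infinity, are the two points lying over
  infinity of the quartic.
\<close>

lemma bij_betw_jacobi_quartic_jacobi_elliptic:
  fixes a b :: "'k::field"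
  assumes two: "(2::'k) \<noteq> 0" and nz: "(a\<^sup>2 - 4 * b) * b \<noteq> 0"
  shows "bij_betw (\<lambda>(x, y). (2 * (x\<^sup>2 + y) + a, 2 * x * (2 * (x\<^sup>2 + y) + a)))
           (jacobi_quartic a b)
           {(u, v). u \<noteq> 0 \<and> proj_point (u, v, 1) \<in> jacobi_elliptic a b}"
    (is "bij_betw ?f ?Q ?W")
proof -
  define f where "f = (\<lambda>(x, y). (2 * (x\<^sup>2 + y) + a, 2 * x * (2 * (x\<^sup>2 + y) + a)))"
  define g where "g = (\<lambda>(u, v). (v / (2 * u), (u - a) / 2 - (v / (2 * u))\<^sup>2))"
  have half: "2 * (w / 2) = w" for w :: 'k using two by simp
  have unz: "2 * (x\<^sup>2 + y) + a \<noteq> 0" if q: "y\<^sup>2 = x ^ 4 + a * x\<^sup>2 + b" for x y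
  proof
    assume u0: "2 * (x\<^sup>2 + y) + a = 0"
    have a: "a = - (2 * (x\<^sup>2 + y))" using u0 by (metis add.commute eq_neg_iff_add_eq_0)
    have b: "b = y\<^sup>2 - x ^ 4 - a * x\<^sup>2" using q by simp
    have "a\<^sup>2 - 4 * b = 0"
      unfolding b unfolding a by (simp add: algebra_simps power2_eq_square power4_eq_xxxx)
    then show False using nz by simp
  qed
  have gf: "g (f (x, y)) = (x, y)" if "(x, y) \<in> ?Q" for x y
  proof -
    have u: "2 * (x\<^sup>2 + y) + a \<noteq> 0" using that unz by (simp add: jacobi_quartic_def)
    have x: "2 * x * u / (2 * u) = x" if "u \<noteq> 0" for u using that two by simp
    have y: "(2 * (x\<^sup>2 + y) + a - a) / 2 = x\<^sup>2 + y"
      by (simp only: add_diff_cancel_right' nonzero_mult_div_cancel_left[OF two])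
    show ?thesis unfolding f_def g_def prod.case x[OF u] y by simp
  qed
  have fg: "f (g (u, v)) = (u, v)" if "(u, v) \<in> ?W" for u v
  proof -
    have u: "u \<noteq> 0" using that by simp
    let ?x = "v / (2 * u)"
    have "2 * (?x\<^sup>2 + ((u - a) / 2 - ?x\<^sup>2)) + a = 2 * ((u - a) / 2) + a" by simp
    also have "\<dots> = u" by (simp only: half diff_add_cancel)
    finally have "2 * (?x\<^sup>2 + ((u - a) / 2 - ?x\<^sup>2)) + a = u" .
    moreover have "2 * ?x * u = v" using two u by simp
    ultimately show ?thesis unfolding f_def g_def by (simp only: prod.case)
  qed
  have fW: "f (x, y) \<in> ?W" if "(x, y) \<in> ?Q" for x y
  proof -
    have q: "y\<^sup>2 = x ^ 4 + a * x\<^sup>2 + b" using that by (simp add: jacobi_quartic_def)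
    have b: "b = y\<^sup>2 - x ^ 4 - a * x\<^sup>2" using q by simp
    define u where "u = 2 * (x\<^sup>2 + y) + a"
    have e: "4 * x\<^sup>2 * u = u\<^sup>2 - 2 * a * u + (a\<^sup>2 - 4 * b)"
      unfolding u_def b by (simp add: algebra_simps power2_eq_square power4_eq_xxxx)
    have "(2 * x * u)\<^sup>2 = u * (4 * x\<^sup>2 * u)"
      by (simp add: power2_eq_square algebra_simps)
    also have "\<dots> = u * (u\<^sup>2 + (- 2 * a) * u + (a\<^sup>2 - 4 * b))"
      unfolding e by simp
    finally have "(2 * x * u)\<^sup>2 = u * (u\<^sup>2 + (- 2 * a) * u + (a\<^sup>2 - 4 * b))" .
    then show ?thesis
      using unz[OF q] unfolding f_def jacobi_elliptic_def u_def
      by (simp only: prod.case mem_Collect_eq proj_point_affine_in_weierstrass_curve simp_thms)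
  qed
  have gQ: "g (u, v) \<in> ?Q" if "(u, v) \<in> ?W" for u v
  proof -
    have 1: "u \<noteq> 0" "v\<^sup>2 = u * (u\<^sup>2 - 2 * a * u + (a\<^sup>2 - 4 * b))"
      using that by (simp_all add: jacobi_elliptic_def proj_point_affine_in_weierstrass_curve)
    define x where "x = v / (2 * u)"
    define s where "s = (u - a) / 2"
    have v: "v = 2 * x * u" using 1 two by (simp add: x_def)
    have u: "u = 2 * s + a" unfolding s_def by (simp only: half diff_add_cancel)
    have "u * (u * (4 * x\<^sup>2)) = v\<^sup>2"
      unfolding v by (simp add: algebra_simps power2_eq_square)
    then have "u * (4 * x\<^sup>2) = u\<^sup>2 - 2 * a * u + (a\<^sup>2 - 4 * b)" using 1 by simp
    then have "4 * ((2 * s + a) * x\<^sup>2) = 4 * (s\<^sup>2 - b)"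
      unfolding u by (simp add: algebra_simps power2_eq_square)
    moreover have "(2::'k) * 2 = 4" by simp
    then have "(4::'k) \<noteq> 0" using two by (metis mult_eq_0_iff)
    ultimately have "(2 * s + a) * x\<^sup>2 = s\<^sup>2 - b" using mult_cancel_left[THEN iffD1] by blast
    then have b: "b = s\<^sup>2 - (2 * s + a) * x\<^sup>2" by simp
    have "(s - x\<^sup>2)\<^sup>2 = x ^ 4 + a * x\<^sup>2 + b"
      unfolding b by (simp add: algebra_simps power2_eq_square power4_eq_xxxx)
    then show ?thesis
      unfolding x_def s_def g_def by (simp only: jacobi_quartic_def mem_Collect_eq prod.case)
  qed
  have "bij_betw f ?Q ?W"
  proof (rule bij_betw_byWitness[where f' = g])
    show "\<forall>p\<in>?Q. g (f p) = p" using gf unfolding Ball_def split_paired_All by blast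
    show "\<forall>p\<in>?W. f (g p) = p" using fg unfolding Ball_def split_paired_All by blast
    show "f ` ?Q \<subseteq> ?W" using fW unfolding image_subset_iff Ball_def split_paired_All by blast
    show "g ` ?W \<subseteq> ?Q" using gQ unfolding image_subset_iff Ball_def split_paired_All by blast
  qed
  then show ?thesis unfolding f_def .
qed

definition jacobi_params :: "('q::field \<times> 'q) set" where
  "jacobi_params = {(a, b). (a\<^sup>2 - 4 * b) * b \<noteq> 0}"

text \<open>
  The curve \<open>E\<^bsub>a,b\<^esub>\<close> over the base field is identified with its equation, that is with
  the pair \<open>(a, b)\<close>; two of them are related if they are isomorphic over the algebraic closure.
\<close>

definition jacobi_iso_rel :: "(('q::field \<times> 'q) \<times> ('q \<times> 'q)) set" where
  "jacobi_iso_rel =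
     {((a, b), (a', b')).
        (a, b) \<in> jacobi_params \<and> (a', b') \<in> jacobi_params \<and>
        elliptic_isomorphic (jacobi_elliptic (to_ac a) (to_ac b))
                            (jacobi_elliptic (to_ac a') (to_ac b'))}"

definition jacobi_classes :: "('q::field \<times> 'q) set set" where
  "jacobi_classes = jacobi_params // jacobi_iso_rel"

end

theory Submission
  imports Defs
begin

text \<open>
  Two things have to be shown: that the classes correspond to the values of the j-invariant, and
  that it takes the stated number of values.

  \<^bold>\<open>Isomorphism and j-invariant.\<close> The essential point is that an isomorphism of Weierstrass curves,
  given only locally by forms, is an affine substitution \<open>u' = \<alpha> u + \<beta>\<close>, \<open>v' = \<gamma> v\<close>. The elements
  of the coordinate ring \<open>K[u, v] / (v\<^sup>2 - f u)\<close> of the affine curve are written uniquely as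
  \<open>s u + t u \<cdot> v\<close>. A function that is regular at every affine point lies in this ring
  (\<open>regular_imp_coord_fun\<close>: cancel a polynomial denominator root by root). Since the point at
  infinity is fixed, an isomorphism and its inverse are therefore given by elements of the
  coordinate rings. The degree of the norm \<open>s\<^sup>2 - f t\<^sup>2\<close> measures the pole order at infinity, and a
  comparison of pole orders forces the pulled back coordinates to have the orders \<open>2\<close> and \<open>3\<close>, which
  leaves only affine substitutions (\<open>iso_odd_hyperelliptic_affine_linear\<close>). Over an algebraically
  closed field in which \<open>2\<close> and \<open>3\<close> are invertible, such a substitution exists precisely if the
  j-invariants agree (\<open>elliptic_isomorphic_weierstrass_iff\<close>).

  \<^bold>\<open>Counting.\<close> Up to scaling, the j-invariant is a function of degree three of \<open>c = b / a\<^sup>2\<close>; the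
  curves with \<open>a = 0\<close> give nothing new. The three points of a fibre correspond to the three roots of
  the cubic. If \<open>c\<close> is not a square, only one of these roots is rational, and the fibre of \<open>c\<close>
  over the finite field is \<open>{c}\<close>; this gives \<open>(q - 1) / 2\<close> values. If \<open>c = t\<^sup>2 / 4\<close>, all the
  roots are rational, and the fibre is an orbit of the symmetric group of order six acting on the
  parameter \<open>t\<close> by fractional linear maps. Only the orbits for \<open>j = 1728\<close> and \<open>j = 0\<close> are
  shorter than six. So with \<open>\<epsilon> = 1\<close> or \<open>\<epsilon> = 0\<close> according to whether \<open>j = 0\<close> occurs in this
  way, there are \<open>(q + 1 + 4 \<epsilon>) / 6\<close> such values. As this number is an integer, \<open>q\<close> modulo
  \<open>6\<close> determines \<open>\<epsilon>\<close>. The sum of both counts is \<open>(4 q + 2) / 6\<close> for \<open>\<epsilon> = 1\<close> and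
  \<open>(4 q - 2) / 6\<close> for \<open>\<epsilon> = 0\<close>.
\<close>

section \<open>The coordinate ring of a hyperelliptic curve\<close>

definition affine_curve :: "'k::field poly \<Rightarrow> ('k \<times> 'k) set" where
  "affine_curve f = {(u, v). v\<^sup>2 = poly f u}"

text \<open>
  Modulo \<open>v\<^sup>2 = f u\<close> every polynomial in \<open>u\<close> and \<open>v\<close> reduces to the form \<open>s u + t u \<cdot> v\<close>, so a pair
  of univariate polynomials describes an element of the coordinate ring.
\<close>

definition coord_eval :: "'k::field poly \<Rightarrow> 'k poly \<Rightarrow> 'k \<times> 'k \<Rightarrow> 'k" where
  "coord_eval s t = (\<lambda>(u, v). poly s u + poly t u * v)"

definition coord_fun :: "'k::field poly \<Rightarrow> ('k \<times> 'k \<Rightarrow> 'k) \<Rightarrow> bool" where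
  "coord_fun f F \<longleftrightarrow> (\<exists>s t. \<forall>P\<in>affine_curve f. F P = coord_eval s t P)"

text \<open>
  For odd \<open>degree f\<close> the curve has a single point at infinity, where \<open>u\<close> has a pole of order \<open>2\<close>.
  The norm \<open>s\<^sup>2 - f t\<^sup>2\<close> from the coordinate ring to \<open>K[u]\<close> has twice the pole order of
  \<open>s u + t u \<cdot> v\<close> there, and a polynomial in \<open>u\<close> has twice its degree as pole order; hence the degree
  of the norm is the pole order. Multiplicativity is then the multiplicativity of the norm.
\<close>

definition pole_order :: "'k::field poly \<Rightarrow> ('k \<times> 'k \<Rightarrow> 'k) \<Rightarrow> nat \<Rightarrow> bool" where
  "pole_order f F n \<longleftrightarrow>
     (\<exists>s t. (s, t) \<noteq> (0, 0) \<and> (\<forall>P\<in>affine_curve f. F P = coord_eval s t P) \<and>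
            degree (s\<^sup>2 - f * t\<^sup>2) = n)"

text \<open>Over a finite field, \<open>1 + \<Prod>(X - a)\<close> has no root.\<close>

lemma infinite_UNIV_alg_closed: "infinite (UNIV :: 'k::alg_closed_field set)"
proof
  assume fin: "finite (UNIV :: 'k set)"
  define p :: "'k poly" where "p = (\<Prod>a\<in>UNIV. [:- a, 1:])"
  have "degree p = card (UNIV :: 'k set)"
    unfolding p_def by (subst degree_prod_eq_sum_degree) auto
  then have "degree (p + 1) > 0"
    using fin by (simp add: degree_add_eq_left finite_UNIV_card_ge_0)
  then obtain x where "poly (p + 1) x = 0"
    using alg_closed_imp_poly_has_root by blast
  moreover have "poly p x = 0"
    using fin by (auto simp: p_def poly_prod intro!: prod_zero)
  ultimately show False by simp
qed

lemma poly_0_if_vanishes_off_finite: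
  fixes p :: "'k::alg_closed_field poly"
  assumes "finite Z" "\<And>x. x \<notin> Z \<Longrightarrow> poly p x = 0"
  shows "p = 0"
proof (rule ccontr)
  assume "p \<noteq> 0"
  then have "finite (Z \<union> {x. poly p x = 0})" using assms(1) poly_roots_finite by blast
  moreover have "Z \<union> {x. poly p x = 0} = UNIV" using assms(2) by auto
  ultimately show False using infinite_UNIV_alg_closed[where 'k = 'k] by simp
qed

lemma coord_eval_mult_on_curve:
  assumes "P \<in> affine_curve f"
  shows "coord_eval s t P * coord_eval s' t' P = coord_eval (s * s' + f * t * t') (s * t' + s' * t) P"
proof -
  obtain u v where P: "P = (u, v)" "v\<^sup>2 = poly f u"
    using assms by (auto simp: affine_curve_def)
  show ?thesis
    unfolding P(1) coord_eval_def using P(2)[symmetric]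
    by (simp add: algebra_simps power2_eq_square)
qed

lemma coord_eval_add: "coord_eval s t P + coord_eval s' t' P = coord_eval (s + s') (t + t') P"
  by (cases P) (simp add: coord_eval_def algebra_simps)

lemma coord_fun_add: "coord_fun f F \<Longrightarrow> coord_fun f G \<Longrightarrow> coord_fun f (\<lambda>P. F P + G P)"
  unfolding coord_fun_def by (metis coord_eval_add)

lemma coord_fun_mult: "coord_fun f F \<Longrightarrow> coord_fun f G \<Longrightarrow> coord_fun f (\<lambda>P. F P * G P)"
  unfolding coord_fun_def by (metis coord_eval_mult_on_curve)

lemma coord_fun_const: "coord_fun f (\<lambda>P. c)"
  unfolding coord_fun_def
  by (rule exI[of _ "[:c:]"], rule exI[of _ 0]) (auto simp: coord_eval_def)

lemma coord_fun_poly: "coord_fun f (\<lambda>P. poly p (fst P))"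
  unfolding coord_fun_def
  by (rule exI[of _ p], rule exI[of _ 0]) (auto simp: coord_eval_def)

lemma coord_fun_fst: "coord_fun f fst"
  using coord_fun_poly[of f "[:0, 1:]"] by simp

lemma coord_fun_snd: "coord_fun f snd"
  unfolding coord_fun_def
  by (rule exI[of _ 0], rule exI[of _ 1]) (auto simp: coord_eval_def)

lemma coord_fun_uminus: "coord_fun f F \<Longrightarrow> coord_fun f (\<lambda>P. - F P)"
  using coord_fun_mult[OF coord_fun_const[of f "-1"]] by simp

lemma coord_fun_diff: "coord_fun f F \<Longrightarrow> coord_fun f G \<Longrightarrow> coord_fun f (\<lambda>P. F P - G P)"
  using coord_fun_add[OF _ coord_fun_uminus, of f F G] by simp

lemma coord_fun_power: "coord_fun f F \<Longrightarrow> coord_fun f (\<lambda>P. F P ^ n)"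
  by (induction n) (auto intro: coord_fun_const coord_fun_mult)

lemma coord_fun_sum:
  "finite I \<Longrightarrow> (\<And>i. i \<in> I \<Longrightarrow> coord_fun f (F i)) \<Longrightarrow> coord_fun f (\<lambda>P. \<Sum>i\<in>I. F i P)"
  by (induction I rule: finite_induct) (auto intro: coord_fun_const coord_fun_add)

lemmas coord_fun_intros =
  coord_fun_add coord_fun_mult coord_fun_const coord_fun_poly coord_fun_fst coord_fun_snd
  coord_fun_uminus coord_fun_diff coord_fun_power coord_fun_sum

lemma coord_fun_coord_eval: "coord_fun f (coord_eval s t)"
  unfolding coord_fun_def by blast

text \<open>
  Smoothness is stated through the derivative, which makes sense in every characteristic; it says
  that \<open>f\<close> has no multiple root.
\<close>

locale odd_hyperelliptic =
  fixes f :: "'k::alg_closed_field poly"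
  assumes two: "(2::'k) \<noteq> 0"
    and odd_degree: "odd (degree f)"
    and smooth: "poly f a = 0 \<Longrightarrow> poly (pderiv f) a \<noteq> 0"
begin

lemma f_nonzero [simp]: "f \<noteq> 0"
  using odd_degree by auto

lemma ex_curve_point: "\<exists>v. (u, v) \<in> affine_curve f"
  using nth_root_exists[of 2 "poly f u"] by (auto simp: affine_curve_def)

text \<open>
  Over all but finitely many \<open>u\<close> there are two points \<open>(u, v)\<close> and \<open>(u, - v)\<close>. If
  \<open>s u + t u \<cdot> v\<close> vanishes at both, then \<open>s u = t u = 0\<close>. In particular the representation by \<open>s\<close>
  and \<open>t\<close> is unique, and an identity between coordinate functions may be checked off a finite set.
\<close>

lemma coord_eval_eq_0_off_finite:
  assumes "finite Z" and zero: "\<And>P. P \<in> affine_curve f \<Longrightarrow> fst P \<notin> Z \<Longrightarrow> coord_eval s t P = 0"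
  shows "s = 0 \<and> t = 0"
proof -
  let ?Z = "Z \<union> {u. poly f u = 0}"
  have fin: "finite ?Z" using assms(1) poly_roots_finite[OF f_nonzero] by simp
  have both: "poly s u = 0 \<and> poly t u = 0" if u: "u \<notin> ?Z" for u
  proof -
    obtain v where v: "(u, v) \<in> affine_curve f" using ex_curve_point by blast
    have v2: "v\<^sup>2 = poly f u" using v by (simp add: affine_curve_def)
    have v0: "v \<noteq> 0" using v2 u by auto
    have "(u, - v) \<in> affine_curve f" using v2 by (simp add: affine_curve_def)
    then have e: "poly s u + poly t u * v = 0" "poly s u - poly t u * v = 0"
      using zero[of "(u, v)"] zero[of "(u, - v)"] v u by (auto simp: coord_eval_def)
    have "2 * poly s u = (poly s u + poly t u * v) + (poly s u - poly t u * v)" by simp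
    then have s: "poly s u = 0" using e two by simp
    then show ?thesis using e(1) v0 by simp
  qed
  show ?thesis using poly_0_if_vanishes_off_finite[OF fin] both by blast
qed

lemma coord_fun_eq_0_off_finite:
  assumes "coord_fun f F" "finite Z" "P \<in> affine_curve f"
    and zero: "\<And>P. P \<in> affine_curve f \<Longrightarrow> fst P \<notin> Z \<Longrightarrow> F P = 0"
  shows "F P = 0"
proof -
  obtain s t where st: "\<forall>P\<in>affine_curve f. F P = coord_eval s t P"
    using assms(1) by (auto simp: coord_fun_def)
  have "s = 0 \<and> t = 0"
    using coord_eval_eq_0_off_finite[OF assms(2), of s t] zero st by auto
  then show ?thesis using st assms(3) by (auto simp: coord_eval_def)
qed

lemma coord_eval_unique:
  assumes "\<And>P. P \<in> affine_curve f \<Longrightarrow> coord_eval s t P = coord_eval s' t' P"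
  shows "s = s' \<and> t = t'"
proof -
  have "coord_eval (s - s') (t - t') P = coord_eval s t P - coord_eval s' t' P" for P
    by (cases P) (simp add: coord_eval_def algebra_simps)
  then have "s - s' = 0 \<and> t - t' = 0"
    using coord_eval_eq_0_off_finite[of "{}" "s - s'" "t - t'"] assms by simp
  then show ?thesis by simp
qed

text \<open>
  The two terms of the norm have degrees of different parity, so they cannot cancel.
  Stated as a bound, this yields the ultrametric inequality for pole orders.
\<close>

lemma degree_norm_le_iff:
  "degree (s\<^sup>2 - f * t\<^sup>2) \<le> k \<longleftrightarrow> 2 * degree s \<le> k \<and> (t \<noteq> 0 \<longrightarrow> degree f + 2 * degree t \<le> k)"
proof (cases "t = 0")
  case True
  then show ?thesis by (cases "s = 0") (simp_all add: degree_power_eq)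
next
  case False
  have ds: "degree (s\<^sup>2) = 2 * degree s" by (cases "s = 0") (simp_all add: degree_power_eq)
  have dt: "degree (f * t\<^sup>2) = degree f + 2 * degree t"
    using False by (simp add: degree_mult_eq degree_power_eq)
  have "degree (s\<^sup>2) \<noteq> degree (f * t\<^sup>2)" unfolding ds dt using odd_degree by presburger
  then have "degree (s\<^sup>2 - f * t\<^sup>2) = max (degree (s\<^sup>2)) (degree (f * t\<^sup>2))"
    using degree_add_eq_left[of "- (f * t\<^sup>2)" "s\<^sup>2"] degree_add_eq_right[of "s\<^sup>2" "- (f * t\<^sup>2)"]
    by (cases "degree (s\<^sup>2) < degree (f * t\<^sup>2)") (auto simp: max_def)
  then show ?thesis using False ds dt by simp
qed

lemma norm_nonzero:
  assumes "(s, t) \<noteq> (0, 0)"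
  shows "s\<^sup>2 - f * t\<^sup>2 \<noteq> 0"
proof
  assume eq: "s\<^sup>2 - f * t\<^sup>2 = 0"
  have "t = 0" using degree_norm_le_iff[of s t 0] eq odd_degree by auto
  then show False using eq assms by simp
qed

section \<open>Regular functions on the affine curve\<close>

text \<open>
  A function that is locally a quotient of coordinate functions is itself one as soon as it
  becomes one after multiplication by a polynomial \<open>n\<close> in \<open>u\<close>: a root \<open>a\<close> of \<open>n\<close> can be removed.
  Indeed \<open>n U = s + t v\<close> vanishes at the points over \<open>a\<close>. If there are two of them, then
  \<open>s\<close> and \<open>t\<close> vanish at \<open>a\<close>. If there is only \<open>(a, 0)\<close>, then \<open>v\<close> is a local parameter there and
  \<open>u - a\<close> vanishes twice, so that \<open>t v / (u - a)\<close> could be regular only if \<open>t a = 0\<close>. Having divided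
  \<open>s\<close> and \<open>t\<close> by \<open>u - a\<close>, one obtains a representation valid off the fibre over \<open>a\<close>; the local
  representation of \<open>U\<close> extends it to that fibre.
\<close>

lemma coord_fun_cancel_denominator:
  assumes loc: "\<And>P. P \<in> affine_curve f \<Longrightarrow>
      \<exists>D N. coord_fun f D \<and> coord_fun f N \<and> D P \<noteq> 0 \<and> (\<forall>Q\<in>affine_curve f. D Q * U Q = N Q)"
    and "n \<noteq> 0" and "coord_fun f (\<lambda>P. poly n (fst P) * U P)"
  shows "coord_fun f U"
  using assms(2-)
proof (induction "degree n" arbitrary: n rule: less_induct)
  case less
  show ?case
  proof (cases "degree n = 0")
    case True
    then obtain c where c: "n = [:c:]" by (meson degree_eq_zeroE)
    with less.prems have "c \<noteq> 0" by simp
    moreover have "coord_fun f (\<lambda>P. inverse c * (poly n (fst P) * U P))"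
      by (intro coord_fun_intros less.prems)
    ultimately show ?thesis using c by (simp add: field_simps)
  next
    case False
    then obtain a where "poly n a = 0" using alg_closed_imp_poly_has_root by blast
    then obtain m where n: "n = [:- a, 1:] * m" by (metis dvdE poly_eq_0_iff_dvd)
    have m0: "m \<noteq> 0" using n less.prems by auto
    have dm: "degree m < degree n"
      unfolding n using m0 by (subst degree_mult_eq) auto
    obtain s t where st: "\<And>P. P \<in> affine_curve f \<Longrightarrow> poly n (fst P) * U P = coord_eval s t P"
      using less.prems(2) by (auto simp: coord_fun_def)
    have at_a: "poly s a + poly t a * v = 0" if "(a, v) \<in> affine_curve f" for v
      using st[OF that] by (simp add: coord_eval_def n)
    obtain v where v: "(a, v) \<in> affine_curve f" using ex_curve_point by blast
    then have v2: "v\<^sup>2 = poly f a" by (simp add: affine_curve_def)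
    have "poly s a = 0 \<and> poly t a = 0"
    proof (cases "v = 0")
      case False
      have "(a, - v) \<in> affine_curve f" using v2 by (simp add: affine_curve_def)
      then have e: "poly s a + poly t a * v = 0" "poly s a - poly t a * v = 0"
        using at_a[OF v] at_a[of "- v"] by simp_all
      have "2 * poly s a = (poly s a + poly t a * v) + (poly s a - poly t a * v)" by simp
      then have "poly s a = 0" using e two by simp
      then show ?thesis using e(1) False by simp
    next
      case True
      have sa: "poly s a = 0" using at_a[OF v] True by simp
      then obtain s1 where s: "s = [:- a, 1:] * s1" by (metis dvdE poly_eq_0_iff_dvd)
      have fa: "poly f a = 0" using v2 True by simp
      then obtain k where k: "f = [:- a, 1:] * k" by (metis dvdE poly_eq_0_iff_dvd)
      have "poly (pderiv f) a = poly k a"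
        unfolding k pderiv_mult by (simp add: pderiv_pCons del: mult_pCons_left)
      then have ka: "poly k a \<noteq> 0" using smooth[OF fa] by simp
      obtain D N where DN: "coord_fun f D" "coord_fun f N" "D (a, v) \<noteq> 0"
        "\<And>Q. Q \<in> affine_curve f \<Longrightarrow> D Q * U Q = N Q"
        using loc[OF v] by blast
      \<comment> \<open>\<open>(u - a) G = v D (m (u - a) U - (u - a) s1 - t v) = 0\<close>, using \<open>v\<^sup>2 = (u - a) k\<close>; evaluating
        \<open>G = 0\<close> at \<open>(a, 0)\<close> leaves \<open>t a \<cdot> k a \<cdot> D = 0\<close>.\<close>
      define G where "G = (\<lambda>P. snd P * (poly m (fst P) * N P - poly s1 (fst P) * D P)
                            - poly t (fst P) * poly k (fst P) * D P)"
      have "G (a, v) = 0"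
      proof (rule coord_fun_eq_0_off_finite[where Z = "{a}"])
        show "coord_fun f G" unfolding G_def by (intro coord_fun_intros DN)
        fix Q assume Q: "Q \<in> affine_curve f" "fst Q \<notin> {a}"
        obtain x y where xy: "Q = (x, y)" by (cases Q)
        have y2: "y\<^sup>2 = (x - a) * poly k x"
          using Q by (simp add: affine_curve_def xy k algebra_simps)
        have e: "(x - a) * poly m x * U Q = (x - a) * poly s1 x + poly t x * y"
          using st[OF Q(1)] by (simp add: n s coord_eval_def xy algebra_simps)
        have "(x - a) * G Q = y * ((x - a) * poly m x * (D Q * U Q) - (x - a) * poly s1 x * D Q)
                 - poly t x * y\<^sup>2 * D Q"
          unfolding G_def y2 DN(4)[OF Q(1), symmetric] by (simp add: xy algebra_simps)
        also have "\<dots> = y * D Q * ((x - a) * poly m x * U Q - (x - a) * poly s1 x - poly t x * y)"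
          by (simp add: power2_eq_square algebra_simps)
        also have "\<dots> = 0" unfolding e by simp
        finally show "G Q = 0" using Q(2) xy by simp
      qed (use v in auto)
      then have "poly t a * poly k a * D (a, v) = 0" by (simp add: G_def True)
      then show ?thesis using ka DN(3) True sa by simp
    qed
    then obtain s1 t1 where s: "s = [:- a, 1:] * s1" and t: "t = [:- a, 1:] * t1"
      by (metis dvdE poly_eq_0_iff_dvd)
    have "poly m (fst P) * U P = coord_eval s1 t1 P" if P: "P \<in> affine_curve f" for P
    proof -
      obtain D N where DN: "coord_fun f D" "coord_fun f N" "D P \<noteq> 0"
        "\<And>Q. Q \<in> affine_curve f \<Longrightarrow> D Q * U Q = N Q"
        using loc[OF P] by blast
      have "poly m (fst P) * N P - D P * coord_eval s1 t1 P = 0"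
      proof (rule coord_fun_eq_0_off_finite[where Z = "{a}"])
        show "coord_fun f (\<lambda>P. poly m (fst P) * N P - D P * coord_eval s1 t1 P)"
          by (intro coord_fun_intros DN coord_fun_coord_eval)
        fix Q assume Q: "Q \<in> affine_curve f" "fst Q \<notin> {a}"
        have "(fst Q - a) * (poly m (fst Q) * U Q) = (fst Q - a) * coord_eval s1 t1 Q"
          using st[OF Q(1)] by (simp add: n s t coord_eval_def algebra_simps split: prod.splits)
        then have "poly m (fst Q) * U Q = coord_eval s1 t1 Q" using Q(2) by simp
        then show "poly m (fst Q) * N Q - D Q * coord_eval s1 t1 Q = 0"
          by (simp flip: DN(4)[OF Q(1)] add: algebra_simps)
      qed (use P in auto)
      then have "D P * (poly m (fst P) * U P) = D P * coord_eval s1 t1 P"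
        by (simp flip: DN(4)[OF P] add: algebra_simps)
      then show ?thesis using DN(3) by simp
    qed
    then have "coord_fun f (\<lambda>P. poly m (fst P) * U P)" unfolding coord_fun_def by blast
    then show ?thesis using less.hyps[OF dm m0] by blast
  qed
qed

text \<open>
  The norm of any local denominator is a first polynomial denominator, which is then cancelled
  root by root.
\<close>

lemma regular_imp_coord_fun:
  assumes loc: "\<And>P. P \<in> affine_curve f \<Longrightarrow>
      \<exists>D N. coord_fun f D \<and> coord_fun f N \<and> D P \<noteq> 0 \<and> (\<forall>Q\<in>affine_curve f. D Q * U Q = N Q)"
  shows "coord_fun f U"
proof -
  obtain v where v: "(0, v) \<in> affine_curve f" using ex_curve_point by blast
  obtain D N where DN: "coord_fun f D" "coord_fun f N" "D (0, v) \<noteq> 0"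
    "\<And>Q. Q \<in> affine_curve f \<Longrightarrow> D Q * U Q = N Q"
    using loc[OF v] by blast
  obtain s t where st: "\<And>P. P \<in> affine_curve f \<Longrightarrow> D P = coord_eval s t P"
    using DN(1) by (auto simp: coord_fun_def)
  have "(s, t) \<noteq> (0, 0)" using DN(3) st[OF v] by (auto simp: coord_eval_def)
  then have n0: "s\<^sup>2 - f * t\<^sup>2 \<noteq> 0" by (rule norm_nonzero)
  have "poly (s\<^sup>2 - f * t\<^sup>2) (fst P) * U P = coord_eval s (- t) P * N P"
    if P: "P \<in> affine_curve f" for P
  proof -
    have "coord_eval s (- t) P * N P = coord_eval s (- t) P * coord_eval s t P * U P"
      using DN(4)[OF P] st[OF P] by (simp add: algebra_simps)
    also have "coord_eval s (- t) P * coord_eval s t P = poly (s\<^sup>2 - f * t\<^sup>2) (fst P)"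
      unfolding coord_eval_mult_on_curve[OF P]
      by (cases P) (simp add: coord_eval_def power2_eq_square algebra_simps)
    finally show ?thesis by simp
  qed
  moreover have "coord_fun f (\<lambda>P. coord_eval s (- t) P * N P)"
    by (intro coord_fun_intros DN coord_fun_coord_eval)
  ultimately have "coord_fun f (\<lambda>P. poly (s\<^sup>2 - f * t\<^sup>2) (fst P) * U P)"
    unfolding coord_fun_def by simp
  then show ?thesis using coord_fun_cancel_denominator[OF loc n0] by blast
qed

section \<open>Pole orders at infinity\<close>

lemma pole_order_cong:
  assumes "\<And>P. P \<in> affine_curve f \<Longrightarrow> F P = G P"
  shows "pole_order f F n \<longleftrightarrow> pole_order f G n"
  unfolding pole_order_def using assms by simp

lemma pole_order_unique:
  assumes "pole_order f F m" "pole_order f F n"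
  shows "m = n"
proof -
  obtain s t s' t' where "\<forall>P\<in>affine_curve f. F P = coord_eval s t P" "degree (s\<^sup>2 - f * t\<^sup>2) = m"
    "\<forall>P\<in>affine_curve f. F P = coord_eval s' t' P" "degree (s'\<^sup>2 - f * t'\<^sup>2) = n"
    using assms unfolding pole_order_def by blast
  then show ?thesis using coord_eval_unique[of s t s' t'] by auto
qed

lemma pole_order_mult:
  assumes "pole_order f F m" "pole_order f G n"
  shows "pole_order f (\<lambda>P. F P * G P) (m + n)"
proof -
  obtain s t s' t' where
    st: "(s, t) \<noteq> (0, 0)" "\<forall>P\<in>affine_curve f. F P = coord_eval s t P" "degree (s\<^sup>2 - f * t\<^sup>2) = m"
    and st': "(s', t') \<noteq> (0, 0)" "\<forall>P\<in>affine_curve f. G P = coord_eval s' t' P"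
      "degree (s'\<^sup>2 - f * t'\<^sup>2) = n"
    using assms unfolding pole_order_def by blast
  let ?s = "s * s' + f * t * t'" and ?t = "s * t' + s' * t"
  have N: "?s\<^sup>2 - f * ?t\<^sup>2 = (s\<^sup>2 - f * t\<^sup>2) * (s'\<^sup>2 - f * t'\<^sup>2)"
    by (simp add: power2_eq_square algebra_simps)
  have "(?s, ?t) \<noteq> (0, 0)"
    using N norm_nonzero[OF st(1)] norm_nonzero[OF st'(1)] by auto
  moreover have "degree (?s\<^sup>2 - f * ?t\<^sup>2) = m + n"
    unfolding N using norm_nonzero[OF st(1)] norm_nonzero[OF st'(1)] st(3) st'(3)
    by (simp add: degree_mult_eq)
  moreover have "\<forall>P\<in>affine_curve f. F P * G P = coord_eval ?s ?t P"
    using st(2) st'(2) coord_eval_mult_on_curve by metis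
  ultimately show ?thesis unfolding pole_order_def by blast
qed

text \<open>
  The strong triangle inequality gives \<open>\<le>\<close>; applied to \<open>G = (F + G) - F\<close> it gives \<open>\<ge>\<close>.
\<close>

lemma pole_order_add_less:
  assumes "pole_order f F m" "pole_order f G n" "m < n"
  shows "pole_order f (\<lambda>P. F P + G P) n"
proof -
  obtain s t s' t' where
    st: "(s, t) \<noteq> (0, 0)" "\<forall>P\<in>affine_curve f. F P = coord_eval s t P" "degree (s\<^sup>2 - f * t\<^sup>2) = m"
    and st': "(s', t') \<noteq> (0, 0)" "\<forall>P\<in>affine_curve f. G P = coord_eval s' t' P"
      "degree (s'\<^sup>2 - f * t'\<^sup>2) = n"
    using assms unfolding pole_order_def by blast
  have ultra: "degree ((p + p')\<^sup>2 - f * (r + r')\<^sup>2) \<le> k"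
    if "degree (p\<^sup>2 - f * r\<^sup>2) \<le> k" "degree (p'\<^sup>2 - f * r'\<^sup>2) \<le> k" for p p' r r' k
  proof -
    have "degree (p + p') \<le> max (degree p) (degree p')" "degree (r + r') \<le> max (degree r) (degree r')"
      by (rule degree_add_le_max)+
    moreover have "r + r' \<noteq> 0 \<longrightarrow> r \<noteq> 0 \<or> r' \<noteq> 0" by auto
    ultimately show ?thesis
      using that unfolding degree_norm_le_iff by (cases "r = 0"; cases "r' = 0") auto
  qed
  have le: "degree ((s + s')\<^sup>2 - f * (t + t')\<^sup>2) \<le> n"
    using ultra[of s t n s' t'] st(3) st'(3) assms(3) by simp
  moreover have "n \<le> degree ((s + s')\<^sup>2 - f * (t + t')\<^sup>2)"
  proof (rule ccontr)
    assume "\<not> ?thesis"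
    then have "degree ((s + s' + - s)\<^sup>2 - f * (t + t' + - t)\<^sup>2) \<le> n - 1"
      using ultra[of "s + s'" "t + t'" "n - 1" "- s" "- t"] st(3) assms(3) by simp
    then show False using st'(3) assms(3) by simp
  qed
  moreover have "(s + s', t + t') \<noteq> (0, 0)"
  proof
    assume "(s + s', t + t') = (0, 0)"
    then have "s' = - s" "t' = - t" by (auto simp: add_eq_0_iff)
    then show False using st(3) st'(3) assms(3) by simp
  qed
  moreover have "\<forall>P\<in>affine_curve f. F P + G P = coord_eval (s + s') (t + t') P"
    using st(2) st'(2) coord_eval_add by metis
  ultimately show ?thesis unfolding pole_order_def by (meson order_antisym)
qed

lemma pole_order_const: "c \<noteq> 0 \<Longrightarrow> pole_order f (\<lambda>P. c) 0"
  unfolding pole_order_def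
  by (rule exI[of _ "[:c:]"], rule exI[of _ 0]) (auto simp: coord_eval_def power2_eq_square)

lemma pole_order_fst: "pole_order f fst 2"
  unfolding pole_order_def
  by (rule exI[of _ "[:0, 1:]"], rule exI[of _ 0]) (auto simp: coord_eval_def power2_eq_square)

lemma pole_order_snd: "pole_order f snd (degree f)"
  unfolding pole_order_def
  by (rule exI[of _ 0], rule exI[of _ 1]) (auto simp: coord_eval_def power2_eq_square)

lemma pole_order_poly:
  assumes "pole_order f F n" "n > 0" "p \<noteq> 0"
  shows "pole_order f (\<lambda>P. poly p (F P)) (degree p * n)"
  using assms(3)
proof (induction p)
  case (pCons a q)
  show ?case
  proof (cases "q = 0")
    case True
    then show ?thesis using pCons pole_order_const[of a] by simp
  next
    case False
    then have *: "pole_order f (\<lambda>P. F P * poly q (F P)) (n + degree q * n)"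
      using pole_order_mult[OF assms(1) pCons.IH] by simp
    show ?thesis
    proof (cases "a = 0")
      case False
      then show ?thesis
        using pole_order_add_less[OF pole_order_const[OF False] *] assms(2) \<open>q \<noteq> 0\<close> by simp
    qed (use * False in simp)
  qed
qed simp

lemma coord_fun_cases:
  assumes "coord_fun f F"
  obtains c where "\<And>P. P \<in> affine_curve f \<Longrightarrow> F P = c" | n where "n > 0" "pole_order f F n"
proof -
  obtain s t where st: "\<And>P. P \<in> affine_curve f \<Longrightarrow> F P = coord_eval s t P"
    using assms by (auto simp: coord_fun_def)
  show ?thesis
  proof (cases "degree (s\<^sup>2 - f * t\<^sup>2) = 0")
    case True
    then have "degree s = 0" "t = 0"
      using degree_norm_le_iff[of s t 0] odd_degree by auto
    then obtain c where "s = [:c:]" "t = 0" using degree_eq_zeroE by metis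
    then show ?thesis using st that(1)[of c] by (auto simp: coord_eval_def)
  next
    case False
    then have "(s, t) \<noteq> (0, 0)" by auto
    then show ?thesis using st that(2) False unfolding pole_order_def by blast
  qed
qed

end

section \<open>Isomorphisms of hyperelliptic curves\<close>

text \<open>
  Let \<open>u'\<close> and \<open>v'\<close> be the coordinates on the second curve. As the pole order of \<open>v'\<^sup>2 = f' u'\<close>
  pulled back is even and \<open>degree f'\<close> is odd, the pullbacks of \<open>u'\<close> and \<open>v'\<close> have orders \<open>2 m\<close> and
  \<open>m \<cdot> degree f'\<close> for some \<open>m\<close>. The monomials in \<open>u'\<close> and \<open>v'\<close> that span the second
  coordinate ring pull back to functions with distinct orders, all
  divisible by \<open>m\<close>, so \<open>m\<close> divides every order that occurs. Because the pullback is onto, \<open>2\<close> and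
  the odd number \<open>degree f\<close> occur, whence \<open>m = 1\<close>. A function of order \<open>2\<close> is affine linear in \<open>u\<close>.
  A function of order \<open>degree f\<close> is \<open>p u + \<gamma> v\<close>, and its square is free of \<open>v\<close> only if \<open>p = 0\<close>.
\<close>

lemma iso_odd_hyperelliptic_affine_linear:
  assumes "odd_hyperelliptic f" "odd_hyperelliptic f'" and deg: "degree f' = degree f" "degree f > 2"
    and UV: "coord_fun f U" "coord_fun f V"
    and GH: "coord_fun f' G" "coord_fun f' H"
    and maps: "\<And>P. P \<in> affine_curve f \<Longrightarrow> (U P, V P) \<in> affine_curve f'"
    and inverse: "\<And>P. P \<in> affine_curve f \<Longrightarrow> G (U P, V P) = fst P \<and> H (U P, V P) = snd P"
  obtains \<alpha> \<beta> \<gamma> where "\<alpha> \<noteq> 0" "\<And>u. \<gamma>\<^sup>2 * poly f u = poly f' (\<alpha> * u + \<beta>)"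
proof -
  interpret C: odd_hyperelliptic f by fact
  interpret C': odd_hyperelliptic f' by fact
  have V2: "(V P)\<^sup>2 = poly f' (U P)" if "P \<in> affine_curve f" for P
    using maps[OF that] by (simp add: affine_curve_def)
  \<comment> \<open>If \<open>U\<close> were constant, then \<open>V\<close> would take at most two values, and the curve would be finite.\<close>
  obtain n where n: "n > 0" "pole_order f U n"
  proof (rule C.coord_fun_cases[OF UV(1)])
    fix c assume c: "\<And>P. P \<in> affine_curve f \<Longrightarrow> U P = c"
    have "u \<in> G ` Pair c ` {v. poly [:- poly f' c, 0, 1:] v = 0}" for u
    proof -
      obtain v where v: "(u, v) \<in> affine_curve f" using C.ex_curve_point by blast
      have "u = G (c, V (u, v))" using inverse[OF v] c[OF v] by simp
      moreover have "poly [:- poly f' c, 0, 1:] (V (u, v)) = 0"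
        using V2[OF v] c[OF v] by (simp add: power2_eq_square)
      ultimately show ?thesis by blast
    qed
    then have "UNIV \<subseteq> G ` Pair c ` {v. poly [:- poly f' c, 0, 1:] v = 0}" by blast
    moreover have "finite {v. poly [:- poly f' c, 0, 1:] v = 0}" by (rule poly_roots_finite) simp
    ultimately have "finite (UNIV :: 'a set)" by (meson finite_imageI finite_subset)
    then show ?thesis using infinite_UNIV_alg_closed by blast
  qed blast
  have "pole_order f (\<lambda>P. poly f' (U P)) (degree f' * n)"
    using C.pole_order_poly[OF n(2,1) C'.f_nonzero] .
  then have V2_order: "pole_order f (\<lambda>P. V P * V P) (degree f * n)"
    using C.pole_order_cong[of "\<lambda>P. V P * V P" "\<lambda>P. poly f' (U P)"] V2 deg
    by (simp add: power2_eq_square)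
  obtain l where l: "pole_order f V l"
  proof (rule C.coord_fun_cases[OF UV(2)])
    fix c assume c: "\<And>P. P \<in> affine_curve f \<Longrightarrow> V P = c"
    show ?thesis
    proof (cases "c = 0")
      case True
      obtain s t where "(s, t) \<noteq> (0, 0)" "\<forall>P\<in>affine_curve f. V P * V P = coord_eval s t P"
        using V2_order unfolding pole_order_def by blast
      then show ?thesis using C.coord_eval_eq_0_off_finite[of "{}" s t] c True by auto
    next
      case False
      then have "pole_order f V 0"
        using C.pole_order_const[OF False] C.pole_order_cong[of V "\<lambda>P. c"] c by simp
      then show ?thesis by (rule that)
    qed
  qed (use that in blast)
  have "2 * l = degree f * n"
    using C.pole_order_unique[OF C.pole_order_mult[OF l l] V2_order] by simp
  then have "even (degree f * n)" by presburger
  then have "even n" using C.odd_degree by simp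
  then obtain m where m: "n = 2 * m" by blast
  have lm: "l = degree f * m" using \<open>2 * l = degree f * n\<close> m by simp
  have dvd: "m dvd k" if W: "coord_fun f' W" and k: "pole_order f (\<lambda>P. W (U P, V P)) k" for W k
  proof -
    obtain S T where ST: "\<And>P. P \<in> affine_curve f' \<Longrightarrow> W P = coord_eval S T P"
      using W by (auto simp: coord_fun_def)
    have k': "pole_order f (\<lambda>P. poly S (U P) + poly T (U P) * V P) k"
      using k C.pole_order_cong[of "\<lambda>P. W (U P, V P)" "\<lambda>P. poly S (U P) + poly T (U P) * V P" k]
        ST[OF maps] by (simp add: coord_eval_def)
    have oS: "pole_order f (\<lambda>P. poly S (U P)) (degree S * n)" if "S \<noteq> 0"
      using C.pole_order_poly[OF n(2,1) that] .
    have oT: "pole_order f (\<lambda>P. poly T (U P) * V P) (degree T * n + l)" if "T \<noteq> 0"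
      using C.pole_order_mult[OF C.pole_order_poly[OF n(2,1) that] l] .
    have mn: "m dvd degree S * n" "m dvd degree T * n + l" unfolding m lm by simp_all
    consider "S = 0" "T = 0" | "S = 0" "T \<noteq> 0" | "S \<noteq> 0" "T = 0" | "S \<noteq> 0" "T \<noteq> 0" by blast
    then show ?thesis
    proof cases
      case 1
      obtain s t where "(s, t) \<noteq> (0, 0)" "\<forall>P\<in>affine_curve f. 0 = coord_eval s t P"
        using k' 1 unfolding pole_order_def by auto
      then show ?thesis using C.coord_eval_eq_0_off_finite[of "{}" s t] by auto
    next
      case 2
      then show ?thesis using C.pole_order_unique[OF k', of "degree T * n + l"] oT mn by simp
    next
      case 3
      then show ?thesis using C.pole_order_unique[OF k', of "degree S * n"] oS mn by simp
    next
      case 4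
      have "odd (2 * degree T + degree f)" using C.odd_degree by simp
      then have "2 * degree S \<noteq> 2 * degree T + degree f" by presburger
      moreover have "m \<noteq> 0" using n(1) m by simp
      ultimately have "(2 * degree S) * m \<noteq> (2 * degree T + degree f) * m"
        unfolding mult_cancel2 by blast
      moreover have "degree S * n = (2 * degree S) * m"
        "degree T * n + l = (2 * degree T + degree f) * m"
        unfolding m lm by (simp_all add: algebra_simps)
      ultimately have "degree S * n \<noteq> degree T * n + l" by metis
      then consider "degree S * n < degree T * n + l" | "degree T * n + l < degree S * n" by linarith
      then show ?thesis
      proof cases
        case 1
        show ?thesis
          using C.pole_order_unique[OF k' C.pole_order_add_less[OF oS[OF 4(1)] oT[OF 4(2)] 1]] mn
          by simp
      next
        case 2
        show ?thesis
          using C.pole_order_unique[OF _ C.pole_order_add_less[OF oT[OF 4(2)] oS[OF 4(1)] 2], of k]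
            k' mn by (simp add: add.commute)
      qed
    qed
  qed
  have "pole_order f (\<lambda>P. G (U P, V P)) 2"
    using C.pole_order_cong[of "\<lambda>P. G (U P, V P)" fst 2] inverse C.pole_order_fst by simp
  then have "m dvd 2" by (rule dvd[OF GH(1)])
  moreover have "pole_order f (\<lambda>P. H (U P, V P)) (degree f)"
    using C.pole_order_cong[of "\<lambda>P. H (U P, V P)" snd "degree f"] inverse C.pole_order_snd by simp
  then have "m dvd degree f" by (rule dvd[OF GH(2)])
  moreover have "coprime 2 (degree f)" using C.odd_degree by simp
  ultimately have "m = 1" using coprime_common_divisor_nat by blast
  then have n2: "pole_order f U 2" and ld: "pole_order f V (degree f)" using n l m lm by simp_all
  obtain s t where U: "\<And>P. P \<in> affine_curve f \<Longrightarrow> U P = coord_eval s t P"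
    and N: "degree (s\<^sup>2 - f * t\<^sup>2) = 2"
    using n2 unfolding pole_order_def by blast
  have "t = 0" "degree s \<le> 1"
    using C.degree_norm_le_iff[of s t 2] N deg(2) by auto
  moreover have "degree s \<noteq> 0"
    using C.degree_norm_le_iff[of s t 0] N \<open>t = 0\<close> by auto
  ultimately have "degree s = 1" by simp
  then obtain \<beta> \<alpha> where s: "s = [:\<beta>, \<alpha>:]" "\<alpha> \<noteq> 0"
    by (metis degree_pCons_eq_if degree_eq_zeroE One_nat_def Suc_inject pCons_cases pCons_eq_0_iff zero_neq_one)
  have U': "U (u, v) = \<alpha> * u + \<beta>" if "(u, v) \<in> affine_curve f" for u v
    using U[OF that] by (simp add: coord_eval_def s \<open>t = 0\<close>)
  obtain p r where V: "\<And>P. P \<in> affine_curve f \<Longrightarrow> V P = coord_eval p r P"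
    and Np: "degree (p\<^sup>2 - f * r\<^sup>2) = degree f"
    using ld unfolding pole_order_def by blast
  have "degree r = 0"
    using C.degree_norm_le_iff[of p r "degree f"] Np by (cases "r = 0") auto
  then obtain \<gamma> where r: "r = [:\<gamma>:]" using degree_eq_zeroE by blast
  have r0: "r \<noteq> 0"
  proof
    assume "r = 0"
    then have "degree (p\<^sup>2) = degree f" using Np by simp
    then have "2 * degree p = degree f" by (cases "p = 0") (simp_all add: degree_power_eq)
    then show False using C.odd_degree by presburger
  qed
  define h where "h = pcompose f' s"
  have "coord_eval (p\<^sup>2 + f * r\<^sup>2) (2 * p * r) P = coord_eval h 0 P" if P: "P \<in> affine_curve f" for P
  proof -
    have "coord_eval (p\<^sup>2 + f * r\<^sup>2) (2 * p * r) P = (V P)\<^sup>2"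
      using coord_eval_mult_on_curve[OF P, of p r p r] V[OF P]
      by (simp add: power2_eq_square algebra_simps)
    also have "\<dots> = coord_eval h 0 P"
      using V2[OF P] U[OF P] \<open>t = 0\<close>
      by (cases P) (simp add: coord_eval_def h_def poly_pcompose)
    finally show ?thesis .
  qed
  then have eq: "p\<^sup>2 + f * r\<^sup>2 = h" "2 * p * r = 0" using C.coord_eval_unique by blast+
  have "(2 :: 'a poly) \<noteq> 0" using C.two by (simp add: numeral_poly)
  then have "p = 0" using eq(2) r0 by simp
  then have "poly (f * r\<^sup>2) u = poly h u" for u using eq(1) by simp
  then have "\<gamma>\<^sup>2 * poly f u = poly f' (\<alpha> * u + \<beta>)" for u
    by (simp add: r h_def s poly_pcompose algebra_simps)
  then show ?thesis using that s(2) by blast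
qed

section \<open>Projective Weierstrass curves\<close>

lemma proj_point_eq_iff:
  "proj_point (x, y, z) = proj_point (x', y', z') \<longleftrightarrow> (\<exists>c. c \<noteq> 0 \<and> x' = c * x \<and> y' = c * y \<and> z' = c * z)"
proof
  assume "proj_point (x, y, z) = proj_point (x', y', z')"
  moreover have "(x', y', z') \<in> proj_point (x', y', z')"
    by (auto simp: proj_point_def intro!: exI[of _ 1])
  ultimately have "(x', y', z') \<in> proj_point (x, y, z)" by simp
  then show "\<exists>c. c \<noteq> 0 \<and> x' = c * x \<and> y' = c * y \<and> z' = c * z"
    by (auto simp: proj_point_def)
next
  assume "\<exists>c. c \<noteq> 0 \<and> x' = c * x \<and> y' = c * y \<and> z' = c * z"
  then obtain c where c: "c \<noteq> 0" "x' = c * x" "y' = c * y" "z' = c * z" by blast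
  have sub: "proj_point (x, y, z) \<subseteq> proj_point (c * x, c * y, c * z)" if "c \<noteq> 0" for x y z c :: 'a
  proof
    fix p assume "p \<in> proj_point (x, y, z)"
    then obtain d where "d \<noteq> 0" "p = (d * x, d * y, d * z)" by (auto simp: proj_point_def)
    then show "p \<in> proj_point (c * x, c * y, c * z)"
      using that by (auto simp: proj_point_def intro!: exI[of _ "d / c"])
  qed
  show "proj_point (x, y, z) = proj_point (x', y', z')"
    using sub[of c x y z] sub[of "inverse c" x' y' z'] c
    by (simp flip: mult.assoc add: subset_antisym)
qed

lemma proj_point_affine_eq_iff [simp]:
  "proj_point (u, v, 1) = proj_point (u', v', 1) \<longleftrightarrow> u = u' \<and> v = v'"
  by (auto simp: proj_point_eq_iff)

lemma proj_point_affine_neq_point_O [simp]: "proj_point (u, v, 1) \<noteq> point_O"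
  by (auto simp: point_O_def proj_point_eq_iff)

text \<open>
  Homogeneity makes the vanishing of a form independent of the coordinate triple chosen for a
  point, so that the affine triple \<open>(u, v, 1)\<close> may be used throughout.
\<close>

lemma is_form_homogeneous:
  assumes "is_form d F"
  shows "F (c * x, c * y, c * z) = c ^ d * F (x, y, z)"
proof -
  obtain a where a: "\<And>x y z. F (x, y, z) = (\<Sum>i\<le>d. \<Sum>j\<le>d - i. a i j * x ^ i * y ^ j * z ^ (d - i - j))"
    using assms unfolding is_form_def by blast
  have "a i j * (c * x) ^ i * (c * y) ^ j * (c * z) ^ (d - i - j)
          = c ^ d * (a i j * x ^ i * y ^ j * z ^ (d - i - j))" if "i \<le> d" "j \<le> d - i" for i j
  proof -
    have "c ^ i * c ^ j * c ^ (d - i - j) = c ^ d"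
      using that by (simp flip: power_add)
    then show ?thesis by (simp add: power_mult_distrib algebra_simps)
  qed
  then show ?thesis unfolding a sum_distrib_left by (intro sum.cong refl) auto
qed

lemma is_form_affine_coord_fun:
  assumes "is_form d F"
  shows "coord_fun f (\<lambda>P. F (fst P, snd P, 1))"
proof -
  obtain a where a: "\<And>x y z. F (x, y, z) = (\<Sum>i\<le>d. \<Sum>j\<le>d - i. a i j * x ^ i * y ^ j * z ^ (d - i - j))"
    using assms unfolding is_form_def by blast
  show ?thesis unfolding a by (intro coord_fun_intros finite_atMost)
qed

lemma is_form_linear: "is_form 1 (\<lambda>(x, y, z). a * x + b * y + c * z)"
  unfolding is_form_def
  by (rule exI[of _ "\<lambda>i j. if i = 1 then a else if j = 1 then b else c"]) (auto simp: algebra_simps)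

definition weierstrass_poly :: "'k::field \<Rightarrow> 'k \<Rightarrow> 'k poly" where
  "weierstrass_poly A B = [:0, B, A, 1:]"

lemma proj_point_affine_in_weierstrass_curve_iff:
  "proj_point (u, v, 1) \<in> weierstrass_curve A B \<longleftrightarrow> (u, v) \<in> affine_curve (weierstrass_poly A B)"
  by (simp add: proj_point_affine_in_weierstrass_curve affine_curve_def weierstrass_poly_def
      power2_eq_square algebra_simps)

lemma proj_point_in_weierstrass_curve_iff:
  "proj_point (u, v, w) \<in> weierstrass_curve A B \<longleftrightarrow>
     (u, v, w) \<noteq> (0, 0, 0) \<and> v\<^sup>2 * w = u * (u\<^sup>2 + A * u * w + B * w\<^sup>2)"
proof
  assume "proj_point (u, v, w) \<in> weierstrass_curve A B"
  then obtain u' v' w' where *: "(u', v', w') \<noteq> (0, 0, 0)"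
      "v'\<^sup>2 * w' = u' * (u'\<^sup>2 + A * u' * w' + B * w'\<^sup>2)"
    and "proj_point (u', v', w') = proj_point (u, v, w)"
    by (auto simp: weierstrass_curve_def)
  then obtain c where c: "c \<noteq> 0" "u = c * u'" "v = c * v'" "w = c * w'"
    by (auto simp: proj_point_eq_iff)
  have "v\<^sup>2 * w = c ^ 3 * (v'\<^sup>2 * w')"
    unfolding c(2-) by (simp add: power2_eq_square power3_eq_cube)
  also have "\<dots> = u * (u\<^sup>2 + A * u * w + B * w\<^sup>2)"
    unfolding *(2) c(2-) by (simp add: power2_eq_square power3_eq_cube algebra_simps)
  finally show "(u, v, w) \<noteq> (0, 0, 0) \<and> v\<^sup>2 * w = u * (u\<^sup>2 + A * u * w + B * w\<^sup>2)"
    using c *(1) by auto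
qed (auto simp: weierstrass_curve_def)

lemma point_O_in_weierstrass_curve [simp]: "point_O \<in> weierstrass_curve A B"
  by (simp add: point_O_def proj_point_in_weierstrass_curve_iff)

lemma weierstrass_curve_cases:
  assumes "P \<in> weierstrass_curve A B"
  obtains "P = point_O" |
    u v where "P = proj_point (u, v, 1)" "(u, v) \<in> affine_curve (weierstrass_poly A B)"
proof -
  obtain u v w where P: "P = proj_point (u, v, w)"
    and nz: "(u, v, w) \<noteq> (0, 0, 0)" and eq: "v\<^sup>2 * w = u * (u\<^sup>2 + A * u * w + B * w\<^sup>2)"
    using assms by (auto simp: weierstrass_curve_def)
  show ?thesis
  proof (cases "w = 0")
    case True
    then have "u = 0" using eq by simp
    then have "v \<noteq> 0" using nz True by simp
    then have "P = point_O"
      unfolding P point_O_def proj_point_eq_iff using True \<open>u = 0\<close>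
      by (intro exI[of _ "inverse v"]) simp
    then show ?thesis by (rule that)
  next
    case False
    then have "P = proj_point (u / w, v / w, 1)"
      unfolding P proj_point_eq_iff by (intro exI[of _ "inverse w"]) (simp add: field_simps)
    then show ?thesis
      using that(2) assms proj_point_affine_in_weierstrass_curve_iff by blast
  qed
qed

text \<open>
  A root \<open>a \<noteq> 0\<close> that is also a root of the derivative satisfies \<open>2 a + A = 0\<close>, so \<open>a\<close> is a double
  root of \<open>u\<^sup>2 + A u + B\<close> and \<open>A\<^sup>2 = 4 B\<close>.
\<close>

lemma odd_hyperelliptic_weierstrass:
  fixes A B :: "'k::alg_closed_field"
  assumes "(2::'k) \<noteq> 0" "B * (A\<^sup>2 - 4 * B) \<noteq> 0"
  shows "odd_hyperelliptic (weierstrass_poly A B)"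
proof
  show "odd (degree (weierstrass_poly A B))" by (simp add: weierstrass_poly_def)
  fix a assume "poly (weierstrass_poly A B) a = 0"
  moreover have "poly (weierstrass_poly A B) a = a * (a\<^sup>2 + A * a + B)"
    by (simp add: weierstrass_poly_def power2_eq_square algebra_simps)
  ultimately have root: "a = 0 \<or> a\<^sup>2 + A * a + B = 0" by auto
  show "poly (pderiv (weierstrass_poly A B)) a \<noteq> 0"
  proof
    assume "poly (pderiv (weierstrass_poly A B)) a = 0"
    then have d: "3 * a\<^sup>2 + 2 * A * a + B = 0"
      by (simp add: weierstrass_poly_def pderiv_pCons power2_eq_square algebra_simps)
    have "a \<noteq> 0" using d assms(2) by auto
    with root have r: "a\<^sup>2 + A * a + B = 0" by simp
    have "a * (2 * a + A) = (3 * a\<^sup>2 + 2 * A * a + B) - (a\<^sup>2 + A * a + B)"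
      by (simp add: power2_eq_square algebra_simps)
    then have e: "2 * a + A = 0" using d r \<open>a \<noteq> 0\<close> by simp
    have "A\<^sup>2 - 4 * B = (2 * a + A)\<^sup>2 - 4 * (a\<^sup>2 + A * a + B)"
      by (simp add: power2_eq_square algebra_simps)
    then show False using e r assms(2) by simp
  qed
qed (rule assms)

text \<open>
  If the local representation is \<open>(F1 : F2 : F3)\<close> and the image is \<open>(U : V : 1)\<close>, then
  \<open>F3 U = F1\<close> and \<open>F3 V = F2\<close> wherever the three forms do not vanish together; where they do, both
  equations are trivial. So they hold on the whole affine curve, and \<open>U\<close> and \<open>V\<close> are locally
  quotients of coordinate functions with common denominator \<open>F3\<close>.
\<close>

lemma curve_morphism_affine_coord_funs:
  assumes hyp: "odd_hyperelliptic (weierstrass_poly A B)"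
    and mor: "curve_morphism (weierstrass_curve A B) (weierstrass_curve A' B') \<phi>"
    and affine: "\<And>P. P \<in> weierstrass_curve A B \<Longrightarrow> P \<noteq> point_O \<Longrightarrow> \<phi> P \<noteq> point_O"
  obtains U V where "coord_fun (weierstrass_poly A B) U" "coord_fun (weierstrass_poly A B) V"
    and "\<And>P. P \<in> affine_curve (weierstrass_poly A B) \<Longrightarrow>
           (U P, V P) \<in> affine_curve (weierstrass_poly A' B') \<and>
           \<phi> (proj_point (fst P, snd P, 1)) = proj_point (U P, V P, 1)"
proof -
  let ?f = "weierstrass_poly A B" and ?f' = "weierstrass_poly A' B'"
  interpret odd_hyperelliptic ?f by (rule hyp)
  have "\<exists>Q. Q \<in> affine_curve ?f' \<and> \<phi> (proj_point (fst P, snd P, 1)) = proj_point (fst Q, snd Q, 1)"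
    if "P \<in> affine_curve ?f" for P
  proof -
    have P: "proj_point (fst P, snd P, 1) \<in> weierstrass_curve A B"
      using that by (simp add: proj_point_affine_in_weierstrass_curve_iff)
    then have "\<phi> (proj_point (fst P, snd P, 1)) \<in> weierstrass_curve A' B'"
      using mor unfolding curve_morphism_def by blast
    then show ?thesis
      using affine[OF P] by (cases rule: weierstrass_curve_cases) auto
  qed
  then obtain \<Phi> where \<Phi>: "\<And>P. P \<in> affine_curve ?f \<Longrightarrow> \<Phi> P \<in> affine_curve ?f' \<and>
      \<phi> (proj_point (fst P, snd P, 1)) = proj_point (fst (\<Phi> P), snd (\<Phi> P), 1)"
    by metis
  have loc: "\<exists>D N M. coord_fun ?f D \<and> coord_fun ?f N \<and> coord_fun ?f M \<and> D P \<noteq> 0 \<and>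
      (\<forall>Q\<in>affine_curve ?f. D Q * fst (\<Phi> Q) = N Q \<and> D Q * snd (\<Phi> Q) = M Q)"
    if P: "P \<in> affine_curve ?f" for P
  proof -
    have "proj_point (fst P, snd P, 1) \<in> weierstrass_curve A B"
      using P by (simp add: proj_point_affine_in_weierstrass_curve_iff)
    from mor[unfolded curve_morphism_def, THEN conjunct2, THEN bspec, OF this]
    obtain d F1 F2 F3 where loc: "is_form d F1 \<and> is_form d F2 \<and> is_form d F3 \<and>
        (\<exists>p. p \<noteq> (0, 0, 0) \<and> proj_point p = proj_point (fst P, snd P, 1) \<and>
             (F1 p, F2 p, F3 p) \<noteq> (0, 0, 0)) \<and>
        (\<forall>p. p \<noteq> (0, 0, 0) \<and> proj_point p \<in> weierstrass_curve A B \<and>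
             (F1 p, F2 p, F3 p) \<noteq> (0, 0, 0) \<longrightarrow> \<phi> (proj_point p) = proj_point (F1 p, F2 p, F3 p))"
      by (elim exE) (rule that)
    from loc have form: "is_form d F1" "is_form d F2" "is_form d F3" by simp_all
    from loc obtain p where
      p: "proj_point p = proj_point (fst P, snd P, 1)" "(F1 p, F2 p, F3 p) \<noteq> (0, 0, 0)"
      by (elim conjE exE) (rule that)
    from loc have rep: "\<phi> (proj_point q) = proj_point (F1 q, F2 q, F3 q)"
      if "q \<noteq> (0, 0, 0)" "proj_point q \<in> weierstrass_curve A B" "(F1 q, F2 q, F3 q) \<noteq> (0, 0, 0)" for q
      using that by (simp only: simp_thms)
    let ?a = "\<lambda>F (Q :: 'a \<times> 'a). F (fst Q, snd Q, 1 :: 'a) :: 'a"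
    have repr: "\<exists>c. c \<noteq> 0 \<and> ?a F1 Q = c * fst (\<Phi> Q) \<and> ?a F2 Q = c * snd (\<Phi> Q) \<and> ?a F3 Q = c"
      if "Q \<in> affine_curve ?f" "(?a F1 Q, ?a F2 Q, ?a F3 Q) \<noteq> (0, 0, 0)" for Q
    proof -
      have "proj_point (fst (\<Phi> Q), snd (\<Phi> Q), 1) = proj_point (?a F1 Q, ?a F2 Q, ?a F3 Q)"
        using rep[of "(fst Q, snd Q, 1)"] that \<Phi>[OF that(1)]
        by (simp add: proj_point_affine_in_weierstrass_curve_iff)
      then show ?thesis unfolding proj_point_eq_iff by auto
    qed
    have eqs: "?a F3 Q * fst (\<Phi> Q) = ?a F1 Q \<and> ?a F3 Q * snd (\<Phi> Q) = ?a F2 Q"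
      if "Q \<in> affine_curve ?f" for Q
      using repr[OF that] by (cases "(?a F1 Q, ?a F2 Q, ?a F3 Q) = (0, 0, 0)") auto
    obtain x y z where xyz: "p = (x, y, z)" by (cases p)
    then obtain c where "x = c * fst P" "y = c * snd P" "z = c * 1"
      using p(1) proj_point_eq_iff[of "fst P" "snd P" 1 x y z] by auto
    then have "F1 p = c ^ d * ?a F1 P" "F2 p = c ^ d * ?a F2 P" "F3 p = c ^ d * ?a F3 P"
      unfolding xyz by (simp_all only: is_form_homogeneous[OF form(1)]
          is_form_homogeneous[OF form(2)] is_form_homogeneous[OF form(3)])
    then have "(?a F1 P, ?a F2 P, ?a F3 P) \<noteq> (0, 0, 0)" using p(2) by auto
    then have "?a F3 P \<noteq> 0" using repr[OF P] by auto
    then show ?thesis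
      using eqs form[THEN is_form_affine_coord_fun]
      by (intro exI[of _ "?a F3"] exI[of _ "?a F1"] exI[of _ "?a F2"]) blast
  qed
  have "coord_fun ?f (\<lambda>P. fst (\<Phi> P))"
    by (rule regular_imp_coord_fun, drule loc, elim exE conjE, intro exI conjI, assumption+) blast
  moreover have "coord_fun ?f (\<lambda>P. snd (\<Phi> P))"
    by (rule regular_imp_coord_fun, drule loc, elim exE conjE, intro exI conjI) (assumption | blast)+
  ultimately show ?thesis using that[of "\<lambda>P. fst (\<Phi> P)" "\<lambda>P. snd (\<Phi> P)"] \<Phi> by simp
qed

text \<open>
  An isomorphism fixing the point at infinity restricts to an isomorphism of the affine parts, so
  it is given by coordinate functions in both directions and must be a substitution
  \<open>u' = \<alpha> u + \<beta>\<close>, \<open>v' = \<gamma> v\<close>. The three equations compare the coefficients of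
  \<open>\<gamma>\<^sup>2 f u = f' (\<alpha> u + \<beta>)\<close>, with \<open>\<gamma>\<^sup>2 = \<alpha>\<^sup>3\<close> eliminated.
\<close>

lemma elliptic_isomorphic_imp_affine_substitution:
  fixes A B A' B' :: "'k::alg_closed_field"
  assumes two: "(2::'k) \<noteq> 0" and disc: "B * (A\<^sup>2 - 4 * B) \<noteq> 0" "B' * (A'\<^sup>2 - 4 * B') \<noteq> 0"
    and iso: "elliptic_isomorphic (weierstrass_curve A B) (weierstrass_curve A' B')"
  obtains \<alpha> \<beta> where "\<alpha> \<noteq> 0" "3 * \<beta> + A' = \<alpha> * A" "3 * \<beta>\<^sup>2 + 2 * A' * \<beta> + B' = \<alpha>\<^sup>2 * B"
    "\<beta> * (\<beta>\<^sup>2 + A' * \<beta> + B') = 0"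
proof -
  let ?E = "weierstrass_curve A B" and ?E' = "weierstrass_curve A' B'"
  let ?f = "weierstrass_poly A B" and ?f' = "weierstrass_poly A' B'"
  have hyp: "odd_hyperelliptic ?f" "odd_hyperelliptic ?f'"
    using odd_hyperelliptic_weierstrass two disc by blast+
  obtain \<phi> \<psi> where *: "curve_morphism ?E ?E' \<phi> \<and> curve_morphism ?E' ?E \<psi> \<and>
      (\<forall>P\<in>?E. \<psi> (\<phi> P) = P) \<and> (\<forall>P\<in>?E'. \<phi> (\<psi> P) = P) \<and> \<phi> point_O = point_O"
    using iso unfolding elliptic_isomorphic_def by (elim exE) (rule that)
  then have mor: "curve_morphism ?E ?E' \<phi>" "curve_morphism ?E' ?E \<psi>"
    and inverse: "\<And>P. P \<in> ?E \<Longrightarrow> \<psi> (\<phi> P) = P" "\<And>P. P \<in> ?E' \<Longrightarrow> \<phi> (\<psi> P) = P"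
    and O: "\<phi> point_O = point_O"
    by simp_all
  have O': "\<psi> point_O = point_O" using inverse(1)[of point_O] O by simp
  obtain U V where UV: "coord_fun ?f U" "coord_fun ?f V"
    and UV_maps: "\<And>P. P \<in> affine_curve ?f \<Longrightarrow> (U P, V P) \<in> affine_curve ?f' \<and>
           \<phi> (proj_point (fst P, snd P, 1)) = proj_point (U P, V P, 1)"
    using curve_morphism_affine_coord_funs[OF hyp(1) mor(1)] inverse(1) O' by metis
  obtain G H where GH: "coord_fun ?f' G" "coord_fun ?f' H"
    and GH_maps: "\<And>P. P \<in> affine_curve ?f' \<Longrightarrow> (G P, H P) \<in> affine_curve ?f \<and>
           \<psi> (proj_point (fst P, snd P, 1)) = proj_point (G P, H P, 1)"
    using curve_morphism_affine_coord_funs[OF hyp(2) mor(2)] inverse(2) O by metis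
  have GH_UV: "G (U P, V P) = fst P \<and> H (U P, V P) = snd P" if P: "P \<in> affine_curve ?f" for P
  proof -
    have on_E: "proj_point (fst P, snd P, 1) \<in> ?E"
      using P by (simp add: proj_point_affine_in_weierstrass_curve_iff)
    have "proj_point (G (U P, V P), H (U P, V P), 1) = proj_point (fst P, snd P, 1)"
      using inverse(1)[OF on_E] UV_maps[OF P] GH_maps[of "(U P, V P)"]
      by (simp del: proj_point_affine_eq_iff)
    then show ?thesis by simp
  qed
  have deg: "degree ?f' = degree ?f" "degree ?f > 2" by (simp_all add: weierstrass_poly_def)
  have maps: "(U P, V P) \<in> affine_curve ?f'" if "P \<in> affine_curve ?f" for P
    using UV_maps[OF that] by simp
  obtain \<alpha> \<beta> \<gamma> where "\<alpha> \<noteq> 0"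
    and eq: "\<And>u. \<gamma>\<^sup>2 * poly ?f u = poly ?f' (\<alpha> * u + \<beta>)"
    by (rule iso_odd_hyperelliptic_affine_linear[OF hyp deg UV GH maps GH_UV]) (assumption, assumption, rule that)
  have "smult (\<gamma>\<^sup>2) ?f - pcompose ?f' [:\<beta>, \<alpha>:] = 0"
    by (rule poly_0_if_vanishes_off_finite[of "{}"])
      (use eq in \<open>simp_all add: poly_pcompose algebra_simps\<close>)
  then have "smult (\<gamma>\<^sup>2) ?f = pcompose ?f' [:\<beta>, \<alpha>:]" by simp
  then have c: "\<beta> * (\<beta> * (\<beta> + A') + B') = 0"
      "\<gamma>\<^sup>2 * B = \<alpha> * (\<beta> * (\<beta> + A') + B') + \<beta> * (\<alpha> * (\<beta> + A') + \<beta> * \<alpha>)"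
      "\<gamma>\<^sup>2 * A = \<alpha> * (\<alpha> * (\<beta> + A') + \<beta> * \<alpha>) + \<beta> * (\<alpha> * \<alpha>)" "\<gamma>\<^sup>2 = \<alpha> * (\<alpha> * \<alpha>)"
    by (auto simp: weierstrass_poly_def pcompose_pCons algebra_simps)
  have "\<alpha>\<^sup>2 * (3 * \<beta> + A') = \<alpha>\<^sup>2 * (\<alpha> * A)"
    using c(3) unfolding c(4) by (simp add: power2_eq_square algebra_simps)
  moreover have "\<alpha> * (3 * \<beta>\<^sup>2 + 2 * A' * \<beta> + B') = \<alpha> * (\<alpha>\<^sup>2 * B)"
    using c(2) unfolding c(4) by (simp add: power2_eq_square algebra_simps)
  moreover have "\<beta> * (\<beta>\<^sup>2 + A' * \<beta> + B') = 0"
    using c(1) by (simp add: power2_eq_square algebra_simps)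
  ultimately show ?thesis using that[of \<alpha> \<beta>] \<open>\<alpha> \<noteq> 0\<close> by simp
qed

lemma curve_morphism_linear:
  assumes "\<alpha> \<noteq> 0" "\<gamma> \<noteq> 0"
    and L: "L = (\<lambda>(x, y, z). (\<alpha> * x + \<beta> * z, \<gamma> * y, z))"
    and maps: "\<And>p. p \<noteq> (0, 0, 0) \<Longrightarrow> proj_point p \<in> C \<Longrightarrow> proj_point (L p) \<in> D"
    and C: "\<And>P. P \<in> C \<Longrightarrow> \<exists>p. p \<noteq> (0, 0, 0) \<and> P = proj_point p"
  shows "curve_morphism C D ((`) L)" "\<And>p. L ` proj_point p = proj_point (L p)"
proof -
  show img: "L ` proj_point p = proj_point (L p)" for p
    unfolding proj_point_def L by (cases p) (auto simp: image_iff algebra_simps; metis)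
  have nz: "L p \<noteq> (0, 0, 0)" if "p \<noteq> (0, 0, 0)" for p
    using that assms(1,2) by (cases p) (auto simp: L)
  show "curve_morphism C D ((`) L)"
    unfolding curve_morphism_def
  proof (intro conjI ballI)
    fix P assume "P \<in> C"
    then obtain p where p: "p \<noteq> (0, 0, 0)" "P = proj_point p" using C by blast
    show "L ` P \<in> D" using maps[OF p(1)] p(2) \<open>P \<in> C\<close> img by simp
    let ?F1 = "\<lambda>(x, y, z). \<alpha> * x + 0 * y + \<beta> * z"
    let ?F2 = "\<lambda>(x, y, z). 0 * x + \<gamma> * y + 0 * z"
    let ?F3 = "\<lambda>(x, y, z). 0 * x + 0 * y + 1 * z"
    have F: "(?F1 q, ?F2 q, ?F3 q) = L q" for q by (cases q) (simp add: L)
    show "\<exists>d F1 F2 F3. is_form d F1 \<and> is_form d F2 \<and> is_form d F3 \<and>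
        (\<exists>p. p \<noteq> (0, 0, 0) \<and> proj_point p = P \<and> (F1 p, F2 p, F3 p) \<noteq> (0, 0, 0)) \<and>
        (\<forall>p. p \<noteq> (0, 0, 0) \<and> proj_point p \<in> C \<and> (F1 p, F2 p, F3 p) \<noteq> (0, 0, 0) \<longrightarrow>
             L ` proj_point p = proj_point (F1 p, F2 p, F3 p))"
      by (rule exI[of _ 1], rule exI[of _ ?F1], rule exI[of _ ?F2], rule exI[of _ ?F3],
          unfold F, intro conjI is_form_linear exI[of _ p] allI impI)
        (use p nz[OF p(1)] img in auto)
  qed
qed

lemma affine_substitution_imp_elliptic_isomorphic:
  fixes A B A' B' :: "'k::alg_closed_field"
  assumes \<alpha>: "\<alpha> \<noteq> 0" and rel: "3 * \<beta> + A' = \<alpha> * A" "3 * \<beta>\<^sup>2 + 2 * A' * \<beta> + B' = \<alpha>\<^sup>2 * B"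
    "\<beta> * (\<beta>\<^sup>2 + A' * \<beta> + B') = 0"
  shows "elliptic_isomorphic (weierstrass_curve A B) (weierstrass_curve A' B')"
proof -
  obtain \<gamma> where \<gamma>: "\<gamma>\<^sup>2 = \<alpha> ^ 3" using nth_root_exists[of 2 "\<alpha> ^ 3"] by auto
  then have \<gamma>0: "\<gamma> \<noteq> 0" using \<alpha> by auto
  define L where "L = (\<lambda>(x, y, z). (\<alpha> * x + \<beta> * z, \<gamma> * y, z :: 'k))"
  define M where "M = (\<lambda>(x, y, z). (1 / \<alpha> * x + (- \<beta> / \<alpha>) * z, 1 / \<gamma> * y, z :: 'k))"
  have L_M: "L (M p) = p" and M_L: "M (L p) = p" for p
    using \<alpha> \<gamma>0 by (cases p; simp add: L_def M_def field_simps)+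
  have L_iff: "proj_point (L p) \<in> weierstrass_curve A' B' \<longleftrightarrow> proj_point p \<in> weierstrass_curve A B" for p
  proof -
    obtain x y z where p: "p = (x, y, z)" by (cases p)
    define u where "u = \<alpha> * x + \<beta> * z"
    have "u * (u\<^sup>2 + A' * u * z + B' * z\<^sup>2)
            = \<alpha> ^ 3 * x ^ 3 + \<alpha>\<^sup>2 * (3 * \<beta> + A') * x\<^sup>2 * z
              + \<alpha> * (3 * \<beta>\<^sup>2 + 2 * A' * \<beta> + B') * x * z\<^sup>2 + \<beta> * (\<beta>\<^sup>2 + A' * \<beta> + B') * z ^ 3"
      unfolding u_def by (simp add: power2_eq_square power3_eq_cube algebra_simps)
    also have "\<dots> = \<gamma>\<^sup>2 * (x * (x\<^sup>2 + A * x * z + B * z\<^sup>2))"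
      unfolding rel \<gamma> by (simp add: power2_eq_square power3_eq_cube algebra_simps)
    finally have e: "u * (u\<^sup>2 + A' * u * z + B' * z\<^sup>2) = \<gamma>\<^sup>2 * (x * (x\<^sup>2 + A * x * z + B * z\<^sup>2))" .
    have y: "(\<gamma> * y)\<^sup>2 * z = \<gamma>\<^sup>2 * (y\<^sup>2 * z)" by (simp add: power_mult_distrib)
    have "(u, \<gamma> * y, z) \<noteq> (0, 0, 0) \<longleftrightarrow> (x, y, z) \<noteq> (0, 0, 0)"
      using \<alpha> \<gamma>0 by (auto simp: u_def)
    then show ?thesis
      using \<gamma>0 unfolding p L_def prod.case u_def[symmetric] proj_point_in_weierstrass_curve_iff e y
      by simp
  qed
  have pts: "\<exists>p. p \<noteq> (0, 0, 0) \<and> P = proj_point p" if "P \<in> weierstrass_curve a b" for P and a b :: 'k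
    using that by (auto simp: weierstrass_curve_def)
  have L: "curve_morphism (weierstrass_curve A B) (weierstrass_curve A' B') ((`) L)"
    "L ` proj_point p = proj_point (L p)" for p
    by (rule curve_morphism_linear[OF \<alpha> \<gamma>0 L_def]; use L_iff pts in blast)+
  have "1 / \<alpha> \<noteq> 0" "1 / \<gamma> \<noteq> 0" using \<alpha> \<gamma>0 by simp_all
  note M = curve_morphism_linear(1)[OF this M_def, of "weierstrass_curve A' B'" "weierstrass_curve A B"]
  have "curve_morphism (weierstrass_curve A' B') (weierstrass_curve A B) ((`) M)"
    by (rule M) (use L_iff L_M pts in metis)+
  moreover have "L ` point_O = point_O"
    unfolding point_O_def L(2) using \<gamma>0 by (auto simp: L_def proj_point_eq_iff intro: exI[of _ "1 / \<gamma>"])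
  ultimately show ?thesis
    unfolding elliptic_isomorphic_def using L(1) L_M M_L
    by (intro exI[of _ "(`) L"] exI[of _ "(`) M"]) (simp add: image_image)
qed

text \<open>
  Completing the cube brings \<open>27 (u\<^sup>3 + A u\<^sup>2 + B u)\<close> into the form \<open>x\<^sup>3 - 3 P x + Q\<close> with
  \<open>x = 3 u + A\<close>, \<open>P = A\<^sup>2 - 3 B\<close> and \<open>Q = 2 A\<^sup>3 - 9 A B\<close>. An affine substitution with factor \<open>\<alpha>\<close>
  scales \<open>P\<close> by \<open>\<alpha>\<^sup>2\<close> and \<open>Q\<close> by \<open>\<alpha>\<^sup>3\<close>. Over an algebraically closed field such an \<open>\<alpha>\<close> exists
  precisely if \<open>P'\<^sup>3 Q\<^sup>2 = P\<^sup>3 Q'\<^sup>2\<close>, and since \<open>4 P\<^sup>3 - Q\<^sup>2 = 27 B\<^sup>2 (A\<^sup>2 - 4 B)\<close>, this is the equality of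
  j-invariants after clearing denominators.
\<close>

lemma elliptic_isomorphic_weierstrass_iff:
  fixes A B A' B' :: "'k::alg_closed_field"
  assumes two: "(2::'k) \<noteq> 0" and three: "(3::'k) \<noteq> 0"
    and disc: "B * (A\<^sup>2 - 4 * B) \<noteq> 0" "B' * (A'\<^sup>2 - 4 * B') \<noteq> 0"
  shows "elliptic_isomorphic (weierstrass_curve A B) (weierstrass_curve A' B') \<longleftrightarrow>
         (A\<^sup>2 - 3 * B) ^ 3 * (B'\<^sup>2 * (A'\<^sup>2 - 4 * B')) = (A'\<^sup>2 - 3 * B') ^ 3 * (B\<^sup>2 * (A\<^sup>2 - 4 * B))"
    (is "?iso \<longleftrightarrow> ?j")
proof -
  define P where "P = A\<^sup>2 - 3 * B"
  define P' where "P' = A'\<^sup>2 - 3 * B'"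
  define Q where "Q = 2 * A ^ 3 - 9 * A * B"
  define Q' where "Q' = 2 * A' ^ 3 - 9 * A' * B'"
  have twenty_seven: "(27::'k) \<noteq> 0"
  proof -
    have "(27::'k) = 3 * (3 * 3)" by simp
    then show ?thesis using three by (metis mult_eq_0_iff)
  qed
  have D: "4 * P ^ 3 - Q\<^sup>2 = 27 * (B\<^sup>2 * (A\<^sup>2 - 4 * B))"
    unfolding P_def Q_def by (simp add: power2_eq_square power3_eq_cube algebra_simps)
  have D': "4 * P' ^ 3 - Q'\<^sup>2 = 27 * (B'\<^sup>2 * (A'\<^sup>2 - 4 * B'))"
    unfolding P'_def Q'_def by (simp add: power2_eq_square power3_eq_cube algebra_simps)
  have nz: "\<not> (P = 0 \<and> Q = 0)" "\<not> (P' = 0 \<and> Q' = 0)"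
    using D D' disc twenty_seven by auto
  have "?j \<longleftrightarrow> P ^ 3 * (4 * P' ^ 3 - Q'\<^sup>2) = P' ^ 3 * (4 * P ^ 3 - Q\<^sup>2)"
    unfolding D D' unfolding P_def P'_def mult.left_commute[of _ 27] using twenty_seven by simp
  also have "\<dots> \<longleftrightarrow> P' ^ 3 * Q\<^sup>2 = P ^ 3 * Q'\<^sup>2"
    by (auto simp: algebra_simps)
  finally have j: "?j \<longleftrightarrow> P' ^ 3 * Q\<^sup>2 = P ^ 3 * Q'\<^sup>2" .
  show ?thesis
  proof
    assume ?iso
    then obtain \<alpha> \<beta> where r: "3 * \<beta> + A' = \<alpha> * A" "3 * \<beta>\<^sup>2 + 2 * A' * \<beta> + B' = \<alpha>\<^sup>2 * B"
      "\<beta> * (\<beta>\<^sup>2 + A' * \<beta> + B') = 0"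
      using elliptic_isomorphic_imp_affine_substitution[OF two disc] by blast
    have P: "P' = \<alpha>\<^sup>2 * P"
    proof -
      have "P' = (3 * \<beta> + A')\<^sup>2 - 3 * (3 * \<beta>\<^sup>2 + 2 * A' * \<beta> + B')"
        unfolding P'_def by (simp add: power2_eq_square algebra_simps)
      then show ?thesis unfolding r P_def by (simp add: power2_eq_square algebra_simps)
    qed
    have Q: "Q' = \<alpha> ^ 3 * Q"
    proof -
      have "Q' = 2 * (3 * \<beta> + A') ^ 3 - 9 * (3 * \<beta> + A') * (3 * \<beta>\<^sup>2 + 2 * A' * \<beta> + B')
                  + 27 * (\<beta> * (\<beta>\<^sup>2 + A' * \<beta> + B'))"
        unfolding Q'_def by (simp add: power2_eq_square power3_eq_cube algebra_simps)
      then show ?thesis unfolding r Q_def by (simp add: power2_eq_square power3_eq_cube algebra_simps)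
    qed
    show ?j unfolding j P Q by (simp add: power_mult_distrib flip: power_mult)
  next
    assume ?j
    then have e: "P' ^ 3 * Q\<^sup>2 = P ^ 3 * Q'\<^sup>2" using j by simp
    have "\<exists>\<alpha>. \<alpha> \<noteq> 0 \<and> P' = \<alpha>\<^sup>2 * P \<and> Q' = \<alpha> ^ 3 * Q"
    proof -
      consider "P = 0" | "P \<noteq> 0" "Q = 0" | "P \<noteq> 0" "Q \<noteq> 0" by blast
      then show ?thesis
      proof cases
        case 1
        with e nz have "P' = 0" "Q \<noteq> 0" "Q' \<noteq> 0" by auto
        moreover obtain \<alpha> where "\<alpha> ^ 3 = Q' / Q" using nth_root_exists[of 3 "Q' / Q"] by auto
        ultimately show ?thesis using 1 by (intro exI[of _ \<alpha>]) auto
      next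
        case 2
        with e nz have "Q' = 0" "P' \<noteq> 0" by auto
        moreover obtain \<alpha> where "\<alpha>\<^sup>2 = P' / P" using nth_root_exists[of 2 "P' / P"] by auto
        ultimately show ?thesis using 2 by (intro exI[of _ \<alpha>]) auto
      next
        case 3
        with e nz have nz': "P' \<noteq> 0" "Q' \<noteq> 0" by auto
        \<comment> \<open>The quotient of the two required powers \<open>\<alpha>\<^sup>3 = Q' / Q\<close> and \<open>\<alpha>\<^sup>2 = P' / P\<close>.\<close>
        define \<alpha> where "\<alpha> = (Q' * P) / (Q * P')"
        have "\<alpha>\<^sup>2 * P = (P ^ 3 * Q'\<^sup>2) / (Q\<^sup>2 * P'\<^sup>2)"
          unfolding \<alpha>_def by (simp add: power2_eq_square power3_eq_cube mult_ac)
        also have "\<dots> = P'" unfolding e[symmetric]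
          using 3 nz' by (simp add: power2_eq_square power3_eq_cube)
        finally have P: "\<alpha>\<^sup>2 * P = P'" .
        have "\<alpha> ^ 3 * Q = (\<alpha>\<^sup>2 * P) * (\<alpha> * Q / P)"
          using 3 by (simp add: power2_eq_square power3_eq_cube)
        also have "\<dots> = Q'" unfolding P unfolding \<alpha>_def using 3 nz' by simp
        finally show ?thesis using P 3 nz' by (intro exI[of _ \<alpha>]) (auto simp: \<alpha>_def)
      qed
    qed
    then obtain \<alpha> where \<alpha>: "\<alpha> \<noteq> 0" "P' = \<alpha>\<^sup>2 * P" "Q' = \<alpha> ^ 3 * Q" by blast
    define \<beta> where "\<beta> = (\<alpha> * A - A') / 3"
    have "3 * \<beta> = \<alpha> * A - A'"
      unfolding \<beta>_def times_divide_eq_right by (rule nonzero_mult_div_cancel_left[OF three])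
    then have r1: "3 * \<beta> + A' = \<alpha> * A" by simp
    have "3 * (3 * \<beta>\<^sup>2 + 2 * A' * \<beta> + B') = (3 * \<beta> + A')\<^sup>2 - P'"
      unfolding P'_def by (simp add: power2_eq_square algebra_simps)
    also have "\<dots> = 3 * (\<alpha>\<^sup>2 * B)"
      unfolding r1 \<alpha>(2) P_def by (simp add: power2_eq_square algebra_simps)
    finally have r2: "3 * \<beta>\<^sup>2 + 2 * A' * \<beta> + B' = \<alpha>\<^sup>2 * B"
      unfolding mult_left_cancel[OF three] .
    have "27 * (\<beta> * (\<beta>\<^sup>2 + A' * \<beta> + B'))
        = Q' - 2 * (3 * \<beta> + A') ^ 3 + 9 * (3 * \<beta> + A') * (3 * \<beta>\<^sup>2 + 2 * A' * \<beta> + B')"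
      unfolding Q'_def by (simp add: power2_eq_square power3_eq_cube algebra_simps)
    also have "\<dots> = 0"
      unfolding r1 r2 \<alpha>(3) Q_def by (simp add: power2_eq_square power3_eq_cube algebra_simps)
    finally have "\<beta> * (\<beta>\<^sup>2 + A' * \<beta> + B') = 0" using twenty_seven by simp
    then show ?iso using affine_substitution_imp_elliptic_isomorphic[OF \<alpha>(1) r1 r2] by blast
  qed
qed

section \<open>The j-invariant of a Jacobi quartic\<close>

definition jacobi_j :: "'q::field \<Rightarrow> 'q \<Rightarrow> 'q" where
  "jacobi_j a b = 16 * (a\<^sup>2 + 12 * b) ^ 3 / (b * (a\<^sup>2 - 4 * b)\<^sup>2)"

text \<open>
  For \<open>a \<noteq> 0\<close> the j-invariant depends only on \<open>c = b / a\<^sup>2\<close>.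
\<close>

definition j_of_ratio :: "'q::field \<Rightarrow> 'q" where
  "j_of_ratio c = 16 * (1 + 12 * c) ^ 3 / (c * (1 - 4 * c)\<^sup>2)"

text \<open>
  This is the j-invariant for \<open>c = t\<^sup>2 / 4\<close>. With \<open>a = 1\<close> the cubic \<open>u (u\<^sup>2 - 2 u + 1 - 4 c)\<close> then
  has the roots \<open>0\<close> and \<open>1 \<plusminus> t\<close>.
\<close>

definition j_of_root :: "'q::field \<Rightarrow> 'q" where
  "j_of_root t = 64 * (1 + 3 * t\<^sup>2) ^ 3 / (t\<^sup>2 * (1 - t\<^sup>2)\<^sup>2)"

lemma numeral_3_smooth_nonzero:
  assumes two: "(2::'q::idom) \<noteq> 0" and three: "(3::'q) \<noteq> 0"
  shows "(4::'q) \<noteq> 0" "(8::'q) \<noteq> 0" "(9::'q) \<noteq> 0" "(12::'q) \<noteq> 0"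
    "(16::'q) \<noteq> 0" "(36::'q) \<noteq> 0" "(64::'q) \<noteq> 0" "(256::'q) \<noteq> 0"
proof -
  have *: "(4::'q) = 2 * 2" "(8::'q) = 2 * (2 * 2)" "(9::'q) = 3 * 3"
    "(12::'q) = 2 * (2 * 3)" "(16::'q) = 2 * (2 * (2 * 2))" "(36::'q) = 2 * 3 * (2 * 3)"
    "(64::'q) = 2 * 2 * 2 * (2 * 2 * 2)" "(256::'q) = 2 * 2 * 2 * 2 * (2 * 2 * 2 * 2)"
    by simp_all
  show "(4::'q) \<noteq> 0" "(8::'q) \<noteq> 0" "(9::'q) \<noteq> 0" "(12::'q) \<noteq> 0"
    "(16::'q) \<noteq> 0" "(36::'q) \<noteq> 0" "(64::'q) \<noteq> 0" "(256::'q) \<noteq> 0"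
    unfolding * using two three by (simp_all only: mult_eq_0_iff simp_thms)
qed

lemma neq_uminus_self:
  assumes "(2::'q::idom) \<noteq> 0" "y \<noteq> 0"
  shows "(y::'q) \<noteq> - y"
  using assms by (metis add.right_inverse mult_2 mult_eq_0_iff)

lemma jacobi_elliptic_isomorphic_iff:
  fixes a b a' b' :: "'q::field"
  assumes two: "(2::'q) \<noteq> 0" and three: "(3::'q) \<noteq> 0"
    and params: "(a, b) \<in> jacobi_params" "(a', b') \<in> jacobi_params"
  shows "elliptic_isomorphic (jacobi_elliptic (to_ac a) (to_ac b)) (jacobi_elliptic (to_ac a') (to_ac b'))
         \<longleftrightarrow> jacobi_j a b = jacobi_j a' b'"
proof -
  note nz = numeral_3_smooth_nonzero[OF two three]
  let ?A = "\<lambda>a :: 'q. - 2 * to_ac a" and ?B = "\<lambda>a b :: 'q. (to_ac a)\<^sup>2 - 4 * to_ac b"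
  have two': "(2 :: 'q alg_closure) \<noteq> 0" and three': "(3 :: 'q alg_closure) \<noteq> 0"
    using two three to_ac_eq_0_iff[of "2 :: 'q"] to_ac_eq_0_iff[of "3 :: 'q"] by simp_all
  have P: "(?A a)\<^sup>2 - 3 * ?B a b = to_ac (a\<^sup>2 + 12 * b)" for a b
    by (simp add: power2_eq_square algebra_simps)
  have "(?A a)\<^sup>2 - 4 * ?B a b = to_ac (16 * b)" for a b
    by (simp add: power2_eq_square algebra_simps)
  then have disc: "?B a b * ((?A a)\<^sup>2 - 4 * ?B a b) = to_ac ((a\<^sup>2 - 4 * b) * (16 * b))"
    and disc': "(?B a b)\<^sup>2 * ((?A a)\<^sup>2 - 4 * ?B a b) = to_ac ((a\<^sup>2 - 4 * b)\<^sup>2 * (16 * b))" for a b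
    by simp_all
  have disc0: "?B a b * ((?A a)\<^sup>2 - 4 * ?B a b) \<noteq> 0" if "(a, b) \<in> jacobi_params" for a b
    using that nz(5) unfolding disc to_ac_eq_0_iff by (auto simp: jacobi_params_def)
  have "elliptic_isomorphic (jacobi_elliptic (to_ac a) (to_ac b)) (jacobi_elliptic (to_ac a') (to_ac b'))
     \<longleftrightarrow> to_ac ((a\<^sup>2 + 12 * b) ^ 3 * ((a'\<^sup>2 - 4 * b')\<^sup>2 * (16 * b')))
         = to_ac ((a'\<^sup>2 + 12 * b') ^ 3 * ((a\<^sup>2 - 4 * b)\<^sup>2 * (16 * b)))"
    unfolding jacobi_elliptic_def
      elliptic_isomorphic_weierstrass_iff[OF two' three' disc0[OF params(1)] disc0[OF params(2)]]
    unfolding P disc' by (simp only: to_ac_mult to_ac_power)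
  also have "\<dots> \<longleftrightarrow> jacobi_j a b = jacobi_j a' b'"
  proof -
    have "b * (a\<^sup>2 - 4 * b)\<^sup>2 \<noteq> 0" "b' * (a'\<^sup>2 - 4 * b')\<^sup>2 \<noteq> 0"
      using params by (auto simp: jacobi_params_def)
    then show ?thesis
      unfolding to_ac_eq_iff jacobi_j_def by (subst frac_eq_eq) (auto simp: mult_ac)
  qed
  finally show ?thesis .
qed

lemma card_quotient_kernel:
  assumes "finite A"
  shows "card (A // {(x, y). x \<in> A \<and> y \<in> A \<and> g x = g y}) = card (g ` A)"
proof -
  let ?K = "{(x, y). x \<in> A \<and> y \<in> A \<and> g x = g y}"
  have "A // ?K = (\<lambda>x. ?K `` {x}) ` A" by (auto simp: quotient_def)
  also have "\<dots> = (\<lambda>x. {y \<in> A. g y = g x}) ` A" by (intro image_cong) auto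
  finally have "A // ?K = (\<lambda>z. {x \<in> A. g x = z}) ` g ` A" by (simp add: image_image)
  moreover have "inj_on (\<lambda>z. {x \<in> A. g x = z}) (g ` A)" by (rule inj_onI) blast
  ultimately show ?thesis by (simp add: card_image)
qed

lemma card_jacobi_classes:
  assumes "(2::'q::{finite, field}) \<noteq> 0" "(3::'q) \<noteq> 0"
  shows "card (jacobi_classes :: ('q \<times> 'q) set set)
         = card ((\<lambda>(a, b). jacobi_j a b) ` (jacobi_params :: ('q \<times> 'q) set))"
proof -
  have rel: "jacobi_iso_rel = {(x, y). x \<in> (jacobi_params :: ('q \<times> 'q) set) \<and> y \<in> jacobi_params \<and>
      (\<lambda>(a, b). jacobi_j a b) x = (\<lambda>(a, b). jacobi_j a b) y}"
    unfolding jacobi_iso_rel_def using jacobi_elliptic_isomorphic_iff[OF assms] by auto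
  show ?thesis unfolding jacobi_classes_def rel by (rule card_quotient_kernel) simp
qed

text \<open>
  The curves with \<open>a = 0\<close> have j-invariant \<open>1728 = 12\<^sup>3\<close>, which is also attained at \<open>c = 1 / 36\<close>, so
  they contribute no further value.
\<close>

lemma jacobi_j_image:
  assumes two: "(2::'q::field) \<noteq> 0" and three: "(3::'q) \<noteq> 0"
  shows "(\<lambda>(a, b). jacobi_j a b) ` jacobi_params = j_of_ratio ` {c :: 'q. c \<noteq> 0 \<and> 4 * c \<noteq> 1}"
proof (intro subset_antisym subsetI)
  note nz = numeral_3_smooth_nonzero[OF two three]
  fix j :: 'q assume "j \<in> (\<lambda>(a, b). jacobi_j a b) ` jacobi_params"
  then obtain a b where j: "j = jacobi_j a b" and ab: "a\<^sup>2 - 4 * b \<noteq> 0" "b \<noteq> 0"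
    by (auto simp: jacobi_params_def)
  show "j \<in> j_of_ratio ` {c. c \<noteq> 0 \<and> 4 * c \<noteq> 1}"
  proof (cases "a = 0")
    case False
    define c where "c = b / a\<^sup>2"
    have b: "b = c * a\<^sup>2" using False by (simp add: c_def)
    have num: "a\<^sup>2 + 12 * b = a\<^sup>2 * (1 + 12 * c)" and den: "a\<^sup>2 - 4 * b = a\<^sup>2 * (1 - 4 * c)"
      unfolding b by (simp_all add: algebra_simps)
    have "j = (a ^ 6 * (16 * (1 + 12 * c) ^ 3)) / (a ^ 6 * (c * (1 - 4 * c)\<^sup>2))"
      unfolding j jacobi_j_def num den unfolding b
      by (simp add: power_mult_distrib power2_eq_square power3_eq_cube eval_nat_numeral mult_ac)
    also have "\<dots> = j_of_ratio c" unfolding j_of_ratio_def using False by simp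
    finally show ?thesis using ab den b by (intro image_eqI[of _ _ c]) auto
  next
    case True
    have "j = 16 * 12 ^ 3 * b ^ 3 / (16 * b ^ 3)"
      unfolding j jacobi_j_def True by (simp add: power_mult_distrib power2_eq_square power3_eq_cube mult_ac)
    also have "\<dots> = 12 ^ 3" using ab(2) nz by simp
    finally have j: "j = 12 ^ 3" .
    have c1: "1 + 12 * (1 / 36) = 4 / (3::'q)" "1 - 4 * (1 / 36) = 8 / (9::'q)"
      using nz three by (simp_all add: field_simps)
    have "j_of_ratio (1 / 36 :: 'q) = 12 ^ 3"
      unfolding j_of_ratio_def c1 using nz three by (simp add: field_simps)
    moreover have "4 * (1 / 36) \<noteq> (1::'q)"
    proof
      assume "4 * (1 / 36) = (1::'q)"
      then have "8 / (9::'q) = 0" unfolding c1(2)[symmetric] by (simp only: diff_self)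
      then show False using nz by simp
    qed
    ultimately show ?thesis using nz j by (intro image_eqI[of _ _ "1 / 36"]) auto
  qed
next
  fix j :: 'q assume "j \<in> j_of_ratio ` {c. c \<noteq> 0 \<and> 4 * c \<noteq> 1}"
  then obtain c where "j = jacobi_j 1 c" "(1, c) \<in> jacobi_params"
    by (auto simp: j_of_ratio_def jacobi_j_def jacobi_params_def)
  then show "j \<in> (\<lambda>(a, b). jacobi_j a b) ` jacobi_params" by force
qed

section \<open>Counting j-invariants\<close>

lemma j_of_ratio_square: "j_of_ratio (t\<^sup>2 / 4) = j_of_root (t::'q::field)" if "(4::'q) \<noteq> 0"
proof -
  have four: "4 * (t\<^sup>2 / 4) = t\<^sup>2" using that by simp
  have "(12::'q) = 3 * 4" by simp
  then have twelve: "12 * (t\<^sup>2 / 4) = 3 * t\<^sup>2" by (simp only: mult.assoc four)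
  have "j_of_ratio (t\<^sup>2 / 4) = 16 * (1 + 3 * t\<^sup>2) ^ 3 / (t\<^sup>2 / 4 * (1 - t\<^sup>2)\<^sup>2)"
    unfolding j_of_ratio_def four twelve ..
  also have "\<dots> = j_of_root t" unfolding j_of_root_def using that by simp
  finally show ?thesis .
qed

text \<open>
  The fibre of the degree three map \<open>j_of_ratio\<close> through \<open>c\<close> consists of the models obtained by
  moving each of the three roots of the cubic to \<open>0\<close>. The two other roots are rational only if
  \<open>c\<close> is a square. In formulas, the other points \<open>x\<close> of the fibre are the roots of a quadratic
  polynomial \<open>W\<close> whose discriminant is \<open>c\<close> times a square.
\<close>

lemma j_of_ratio_eq_nonsquare:
  fixes c x :: "'q::field"
  assumes two: "(2::'q) \<noteq> 0" and three: "(3::'q) \<noteq> 0"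
    and c: "c \<noteq> 0" "4 * c \<noteq> 1" and x: "x \<noteq> 0" "4 * x \<noteq> 1"
    and eq: "j_of_ratio x = j_of_ratio c" and nonsquare: "\<And>t. c \<noteq> t\<^sup>2 / 4"
  shows "x = c"
proof (rule ccontr)
  note nz = numeral_3_smooth_nonzero[OF two three]
  assume "x \<noteq> c"
  have "x * (1 - 4 * x)\<^sup>2 \<noteq> 0" "c * (1 - 4 * c)\<^sup>2 \<noteq> 0" using c x by auto
  then have e: "(1 + 12 * x) ^ 3 * (c * (1 - 4 * c)\<^sup>2) = (1 + 12 * c) ^ 3 * (x * (1 - 4 * x)\<^sup>2)"
    using eq nz unfolding j_of_ratio_def by (subst (asm) frac_eq_eq) (auto simp: mult.assoc)
  define W where "W = 16 * x\<^sup>2 * (1 - 36 * c)\<^sup>2 - 8 * x * ((1 + 12 * c)\<^sup>2 + 64 * c) + (1 - 4 * c)\<^sup>2"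
  have "(x - c) * W = (1 + 12 * c) ^ 3 * (x * (1 - 4 * x)\<^sup>2) - (1 + 12 * x) ^ 3 * (c * (1 - 4 * c)\<^sup>2)"
    unfolding W_def by (simp add: power2_eq_square power3_eq_cube algebra_simps)
  then have W: "W = 0" using e \<open>x \<noteq> c\<close> by simp
  \<comment> \<open>Completing the square in \<open>(1 - 36 c)\<^sup>2 W\<close>, which also covers the case that \<open>W\<close> is linear in \<open>x\<close>.\<close>
  define Z where "Z = 4 * x * (1 - 36 * c)\<^sup>2 - ((1 + 12 * c)\<^sup>2 + 64 * c)"
  have "Z\<^sup>2 = (1 - 36 * c)\<^sup>2 * W + 256 * c * (1 + 12 * c)\<^sup>2"
    unfolding Z_def W_def by (simp add: power2_eq_square algebra_simps)
  then have Z: "Z\<^sup>2 = 256 * c * (1 + 12 * c)\<^sup>2" using W by simp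
  show False
  proof (cases "1 + 12 * c = 0")
    case True
    then have "(1 + 12 * x) ^ 3 * (c * (1 - 4 * c)\<^sup>2) = 0" using e by simp
    then have "1 + 12 * x = 1 + 12 * c" using c True by auto
    then show False using \<open>x \<noteq> c\<close> nz by simp
  next
    case False
    define k where "k = 1 + 12 * c"
    have den: "(8 * k)\<^sup>2 * 4 = 256 * k\<^sup>2" unfolding power_mult_distrib by simp
    have "c = (Z / (8 * k))\<^sup>2 / 4"
      unfolding power_divide Z divide_divide_eq_left k_def[symmetric] den
      using False nz(8) by (simp add: k_def)
    then show False using nonsquare by blast
  qed
qed

text \<open>
  The symmetric group on the three roots of the cubic acts on the parameter by
  \<open>t \<mapsto> \<plusminus> t, \<plusminus> (1 - t) / (1 + 3 t), \<plusminus> (1 + t) / (1 - 3 t)\<close>, and the fibres of the j-invariant are its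
  orbits. The equations are kept free of denominators because \<open>1 \<plusminus> 3 t\<close> may vanish, in which case
  the corresponding image is the point at infinity.
\<close>

lemma j_of_root_eq_iff:
  fixes t x :: "'q::field"
  assumes two: "(2::'q) \<noteq> 0" and three: "(3::'q) \<noteq> 0"
    and t: "t \<noteq> 0" "t\<^sup>2 \<noteq> 1" and x: "x \<noteq> 0" "x\<^sup>2 \<noteq> 1"
  shows "j_of_root x = j_of_root t \<longleftrightarrow>
         x = t \<or> x = - t \<or> x * (1 + 3 * t) = 1 - t \<or> x * (1 + 3 * t) = - (1 - t) \<or>
         x * (1 - 3 * t) = 1 + t \<or> x * (1 - 3 * t) = - (1 + t)"
proof -
  note nz = numeral_3_smooth_nonzero[OF two three]
  have "x\<^sup>2 * (1 - x\<^sup>2)\<^sup>2 \<noteq> 0" "t\<^sup>2 * (1 - t\<^sup>2)\<^sup>2 \<noteq> 0" using t x by auto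
  then have "j_of_root x = j_of_root t \<longleftrightarrow>
      (1 + 3 * x\<^sup>2) ^ 3 * (t\<^sup>2 * (1 - t\<^sup>2)\<^sup>2) = (1 + 3 * t\<^sup>2) ^ 3 * (x\<^sup>2 * (1 - x\<^sup>2)\<^sup>2)"
    using nz unfolding j_of_root_def by (subst frac_eq_eq) (auto simp: mult.assoc)
  also have "\<dots> \<longleftrightarrow> (1 + 3 * t\<^sup>2) ^ 3 * (x\<^sup>2 * (1 - x\<^sup>2)\<^sup>2)
                 - (1 + 3 * x\<^sup>2) ^ 3 * (t\<^sup>2 * (1 - t\<^sup>2)\<^sup>2) = 0"
    by auto
  also have "(1 + 3 * t\<^sup>2) ^ 3 * (x\<^sup>2 * (1 - x\<^sup>2)\<^sup>2) - (1 + 3 * x\<^sup>2) ^ 3 * (t\<^sup>2 * (1 - t\<^sup>2)\<^sup>2)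
      = ((x - t) * (x + t)) * ((x * (1 + 3 * t) - (1 - t)) * (x * (1 + 3 * t) + (1 - t)))
        * ((x * (1 - 3 * t) - (1 + t)) * (x * (1 - 3 * t) + (1 + t)))"
    by (simp add: power2_eq_square power3_eq_cube algebra_simps)
  also have "\<dots> = 0 \<longleftrightarrow> x = t \<or> x = - t \<or> x * (1 + 3 * t) = 1 - t \<or> x * (1 + 3 * t) = - (1 - t) \<or>
         x * (1 - 3 * t) = 1 + t \<or> x * (1 - 3 * t) = - (1 + t)"
    by (simp only: mult_eq_0_iff right_minus_eq eq_neg_iff_add_eq_0 disj_assoc)
  finally show ?thesis .
qed

text \<open>
  Orbits are free except in two cases. If \<open>9 t\<^sup>2 = 1\<close> (\<open>j = 1728\<close>), the orbit is
  \<open>{1/3, - 1/3, \<infinity>}\<close>, and the point at infinity is not counted. If \<open>3 t\<^sup>2 = - 1\<close> (\<open>j = 0\<close>), then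
  \<open>t\<close> is fixed by the rotations of order three, and the orbit is \<open>{t, - t}\<close>.
\<close>

lemma card_j_of_root_fibre:
  fixes t :: "'q::{finite, field}"
  assumes two: "(2::'q) \<noteq> 0" and three: "(3::'q) \<noteq> 0" and t: "t \<noteq> 0" "t\<^sup>2 \<noteq> 1"
  shows "card {x. x \<noteq> 0 \<and> x\<^sup>2 \<noteq> 1 \<and> j_of_root x = j_of_root t}
         = (if 9 * t\<^sup>2 = 1 \<or> 3 * t\<^sup>2 = - 1 then 2 else 6)"
proof -
  note nz = numeral_3_smooth_nonzero[OF two three]
  let ?F = "{x. x \<noteq> 0 \<and> x\<^sup>2 \<noteq> 1 \<and> j_of_root x = j_of_root t}"
  note double = neq_uminus_self[OF two]
  have t1: "1 - t \<noteq> 0" "1 + t \<noteq> 0"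
    using t(2) by (auto simp: add_eq_0_iff power2_eq_square)
  have F: "?F = {x. x \<noteq> 0 \<and> x\<^sup>2 \<noteq> 1 \<and> (x = t \<or> x = - t \<or> x * (1 + 3 * t) = 1 - t \<or>
      x * (1 + 3 * t) = - (1 - t) \<or> x * (1 - 3 * t) = 1 + t \<or> x * (1 - 3 * t) = - (1 + t))}"
    using j_of_root_eq_iff[OF two three t] by blast
  have prod: "(1 + 3 * t) * (1 - 3 * t) = 1 - 9 * t\<^sup>2" by (simp add: power2_eq_square algebra_simps)
  have pm: "card {t, - t} = 2" using double[OF t(1)] by simp
  consider "9 * t\<^sup>2 = 1" | "3 * t\<^sup>2 = - 1" "9 * t\<^sup>2 \<noteq> 1" | "9 * t\<^sup>2 \<noteq> 1" "3 * t\<^sup>2 \<noteq> - 1" by blast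
  then show ?thesis
  proof cases
    case 1
    consider "1 + 3 * t = 0" | "1 - 3 * t = 0" using prod 1 by auto
    then have "?F = {t, - t}"
    proof cases
      case 1
      then have "3 * t = - 1" by (simp add: add_eq_0_iff)
      then have e: "1 - 3 * t = 2" by simp
      have "2 * t = 3 * t - t" by (simp add: algebra_simps)
      then have e': "1 + t = - 2 * t" using \<open>3 * t = - 1\<close> by simp
      have "x * 2 = - 2 * t \<longleftrightarrow> x = - t" "x * 2 = - (- 2 * t) \<longleftrightarrow> x = t" for x :: 'q
        using two by (auto simp: mult.commute[of _ 2] simp flip: mult_minus_right)
      then show ?thesis unfolding F 1 e unfolding e' using t t1 by auto
    next
      case 2
      then have "3 * t = 1" by simp
      then have e: "1 + 3 * t = 2" by simp
      have "2 * t = 3 * t - t" by (simp add: algebra_simps)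
      then have e': "1 - t = 2 * t" using \<open>3 * t = 1\<close> by simp
      have "x * 2 = 2 * t \<longleftrightarrow> x = t" "x * 2 = - (2 * t) \<longleftrightarrow> x = - t" for x :: 'q
        using two by (auto simp: mult.commute[of _ 2] simp flip: mult_minus_right)
      then show ?thesis unfolding F 2 e unfolding e' using t t1 by auto
    qed
    then show ?thesis using pm 1 by simp
  next
    case 2
    have nz3: "1 + 3 * t \<noteq> 0" "1 - 3 * t \<noteq> 0"
      using prod 2(2) by auto
    have e: "1 - t = - t * (1 + 3 * t)" "1 + t = t * (1 - 3 * t)"
      using 2(1) by (simp_all add: power2_eq_square algebra_simps)
    have "?F = {t, - t}"
      unfolding F e using nz3 t by (auto simp flip: mult_minus_left)
    then show ?thesis using pm 2 by simp
  next
    case 3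
    have nz3: "1 + 3 * t \<noteq> 0" "1 - 3 * t \<noteq> 0"
      using prod 3(1) by auto
    define r where "r = (1 - t) / (1 + 3 * t)"
    define s where "s = (1 + t) / (1 - 3 * t)"
    have r: "1 - t = r * (1 + 3 * t)" and s: "1 + t = s * (1 - 3 * t)"
      using nz3 by (simp_all add: r_def s_def)
    have rs0: "r \<noteq> 0" "s \<noteq> 0" using r s t1 by auto
    have r1: "r\<^sup>2 \<noteq> 1"
    proof
      assume "r\<^sup>2 = 1"
      then have "(1 - t)\<^sup>2 = (1 + 3 * t)\<^sup>2" unfolding r by (simp add: power_mult_distrib)
      then have "8 * (t * (1 + t)) = 0" by (simp add: power2_eq_square algebra_simps)
      then show False using nz t1 t by simp
    qed
    have s1: "s\<^sup>2 \<noteq> 1"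
    proof
      assume "s\<^sup>2 = 1"
      then have "(1 + t)\<^sup>2 = (1 - 3 * t)\<^sup>2" unfolding s by (simp add: power_mult_distrib)
      then have "8 * (t * (1 - t)) = 0" by (simp add: power2_eq_square algebra_simps)
      then show False using nz t1 t by simp
    qed
    have "?F = {t, - t, r, - r, s, - s}"
      unfolding F r s using nz3 t rs0 r1 s1 by (auto simp flip: mult_minus_left)
    moreover have "distinct [t, - t, r, - r, s, - s]"
    proof -
      have "t \<noteq> r"
      proof
        assume "t = r"
        then have "1 - t = t * (1 + 3 * t)" using r by simp
        moreover have "(1 - 3 * t) * (1 + t) = (1 - t) - t * (1 + 3 * t)" by (simp add: algebra_simps)
        ultimately have "(1 - 3 * t) * (1 + t) = 0" by (simp only: diff_self)
        then show False using nz3 t1 by simp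
      qed
      moreover have "t \<noteq> - r"
      proof
        assume "t = - r"
        then have "1 - t = - t * (1 + 3 * t)" using r by simp
        then show False using 3(2) by (simp add: power2_eq_square algebra_simps eq_neg_iff_add_eq_0)
      qed
      moreover have "t \<noteq> s"
      proof
        assume "t = s"
        then have "1 + t = t * (1 - 3 * t)" using s by simp
        then show False using 3(2) by (simp add: power2_eq_square algebra_simps eq_neg_iff_add_eq_0)
      qed
      moreover have "t \<noteq> - s"
      proof
        assume "t = - s"
        then have "1 + t = - t * (1 - 3 * t)" using s by simp
        moreover have "(1 + 3 * t) * (1 - t) = (1 + t) - (- t * (1 - 3 * t))" by (simp add: algebra_simps)
        ultimately have "(1 + 3 * t) * (1 - t) = 0" by (simp only: diff_self)
        then show False using nz3 t1 by simp
      qed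
      moreover have "r \<noteq> s"
      proof
        assume "r = s"
        then have "(1 - t) * (1 - 3 * t) = (1 + t) * (1 + 3 * t)" unfolding r s by simp
        then have "8 * t = 0" by (simp add: algebra_simps)
        then show False using nz t by simp
      qed
      moreover have "r \<noteq> - s"
      proof
        assume "r = - s"
        then have "(1 - t) * (1 - 3 * t) = - (1 + t) * (1 + 3 * t)" unfolding r s by simp
        then have "2 * (3 * t\<^sup>2 + 1) = 0" by (simp add: power2_eq_square algebra_simps)
        then have "3 * t\<^sup>2 + 1 = 0" unfolding mult_eq_0_iff using two by simp
        then show False using 3(2) by (simp add: eq_neg_iff_add_eq_0)
      qed
      moreover have "- x = y \<longleftrightarrow> x = - y" for x y :: 'q by (metis minus_minus)
      ultimately show ?thesis using double[OF t(1)] double[OF rs0(1)] double[OF rs0(2)] by simp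
    qed
    then have "card (set [t, - t, r, - r, s, - s]) = 6" by (subst distinct_card) auto
    ultimately show ?thesis using 3 by simp
  qed
qed

lemma card_eq_sum_card_fibres:
  assumes "finite A"
  shows "card A = (\<Sum>y\<in>h ` A. card {x \<in> A. h x = y})"
  using sum.image_gen[OF assms, of "\<lambda>_. 1 :: nat" h] by simp

lemma card_root_params:
  assumes "(2::'q::{finite, field}) \<noteq> 0"
  shows "card {t :: 'q. t \<noteq> 0 \<and> t\<^sup>2 \<noteq> 1} + 3 = CARD('q)"
proof -
  let ?T = "{t :: 'q. t \<noteq> 0 \<and> t\<^sup>2 \<noteq> 1}"
  have "- ?T = {0, 1, - 1}" by (auto simp: power2_eq_1_iff)
  moreover have "(1::'q) \<noteq> - 1" by (rule neq_uminus_self[OF assms]) simp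
  ultimately have "card (- ?T) = 3" by simp
  moreover have "card (- ?T) = CARD('q) - card ?T" "card ?T \<le> CARD('q)"
    by (simp_all add: Compl_eq_Diff_UNIV card_Diff_subset card_mono)
  ultimately show ?thesis by simp
qed

text \<open>
  The \<open>q - 3\<close> parameters are distributed over fibres of size \<open>6\<close>, except that the fibre of
  \<open>j = 1728\<close>, which always occurs, and that of \<open>j = 0\<close>, which may or may not occur, have size \<open>2\<close>.
\<close>

lemma card_j_of_root_image:
  assumes two: "(2::'q::{finite, field}) \<noteq> 0" and three: "(3::'q) \<noteq> 0"
  defines "T \<equiv> {t :: 'q. t \<noteq> 0 \<and> t\<^sup>2 \<noteq> 1}"
  shows "6 * card (j_of_root ` T) = CARD('q) + (if 0 \<in> j_of_root ` T then 5 else 1)"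
proof -
  note nz = numeral_3_smooth_nonzero[OF two three]
  let ?h = "j_of_root :: 'q \<Rightarrow> 'q"
  have card_T: "card T + 3 = CARD('q)" unfolding T_def by (rule card_root_params[OF two])
  have third: "9 * (1 / 3 :: 'q)\<^sup>2 = 1" using three nz by (simp add: power_divide)
  have third_T: "1 / 3 \<in> T"
  proof -
    have "(1 / 3 :: 'q)\<^sup>2 \<noteq> 1"
    proof
      assume "(1 / 3 :: 'q)\<^sup>2 = 1"
      then have "(9::'q) = 1" using third by simp
      then have "(8::'q) = 0" by (simp add: eq_iff_diff_eq_0[of "9::'q" 1])
      then show False using nz by simp
    qed
    then show ?thesis using three by (simp add: T_def)
  qed
  have h_third: "?h t = ?h (1 / 3) \<longleftrightarrow> 9 * t\<^sup>2 = 1" if "t \<in> T" for t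
  proof -
    have "?h t = ?h (1 / 3) \<longleftrightarrow> t = 1 / 3 \<or> t = - (1 / 3)"
    proof -
      define z :: 'q where "z = 1 / 3"
      have z3: "3 * z = 1" using three by (simp add: z_def)
      then have z0: "z \<noteq> 0" by auto
      have "2 * z = 3 * z - z" "4 * z = 3 * z + z" by (simp_all add: algebra_simps)
      then have e: "1 + 3 * z = 2" "1 - 3 * z = 0" "1 - z = 2 * z" "1 + z = 4 * z"
        unfolding z3 by simp_all
      have cancel: "t * 2 = 2 * z \<longleftrightarrow> t = z" "t * 2 = - (2 * z) \<longleftrightarrow> t = - z"
        using two by (auto simp: mult.commute[of _ 2] simp flip: mult_minus_right)
      have "z \<noteq> 0" "z\<^sup>2 \<noteq> 1" "t \<noteq> 0" "t\<^sup>2 \<noteq> 1"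
        using that third_T by (simp_all add: T_def z_def)
      then have "?h t = ?h z \<longleftrightarrow> t = z \<or> t = - z"
        unfolding j_of_root_eq_iff[OF two three \<open>z \<noteq> 0\<close> \<open>z\<^sup>2 \<noteq> 1\<close> \<open>t \<noteq> 0\<close> \<open>t\<^sup>2 \<noteq> 1\<close>]
        unfolding e cancel using z0 nz(1) by auto
      then show ?thesis unfolding z_def .
    qed
    also have "\<dots> \<longleftrightarrow> (3 * t)\<^sup>2 = 1"
      unfolding power2_eq_1_iff using three by (auto simp: field_simps)
    also have "(3 * t)\<^sup>2 = 9 * t\<^sup>2" by (simp add: power2_eq_square)
    finally show ?thesis .
  qed
  have h_zero: "?h t = 0 \<longleftrightarrow> 3 * t\<^sup>2 = - 1" if "t \<in> T" for t
    using that nz by (auto simp: j_of_root_def T_def eq_neg_iff_add_eq_0 add.commute)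
  have zero_ne: "?h (1 / 3) \<noteq> 0"
  proof -
    have "3 * (1 / 3 :: 'q)\<^sup>2 + 1 = 4 / 3"
      using three nz(3) by (simp add: field_simps power2_eq_square)
    moreover have "4 / 3 \<noteq> (0 :: 'q)" using nz(1) three by simp
    ultimately have "3 * (1 / 3 :: 'q)\<^sup>2 \<noteq> - 1" by (metis add.left_inverse)
    then show ?thesis unfolding h_zero[OF third_T] .
  qed
  define Y where "Y = ?h ` T"
  define S where "S = Y \<inter> {?h (1 / 3), 0}"
  have fibre: "card {x \<in> T. ?h x = y} = (if y \<in> S then 2 else 6)" if y: "y \<in> Y" for y
  proof -
    obtain t where t: "t \<in> T" "y = ?h t" using y by (auto simp: Y_def)
    have "card {x \<in> T. ?h x = y} = (if 9 * t\<^sup>2 = 1 \<or> 3 * t\<^sup>2 = - 1 then 2 else 6)"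
      using card_j_of_root_fibre[OF two three, of t] t by (simp add: T_def conj_assoc)
    then show ?thesis using h_third[OF t(1)] h_zero[OF t(1)] t y by (auto simp: S_def)
  qed
  have "finite Y" "S \<subseteq> Y" by (auto simp: Y_def S_def)
  have "card T = (\<Sum>y\<in>Y. card {x \<in> T. ?h x = y})"
    unfolding Y_def by (rule card_eq_sum_card_fibres) simp
  also have "\<dots> = (\<Sum>y\<in>Y. if y \<in> S then 2 else 6)" by (intro sum.cong refl fibre)
  also have "\<dots> = (\<Sum>y\<in>S. 2) + (\<Sum>y\<in>Y - S. 6)"
    using sum.subset_diff[OF \<open>S \<subseteq> Y\<close> \<open>finite Y\<close>, of "\<lambda>y. if y \<in> S then 2 else 6 :: nat"] by simp
  also have "\<dots> = 2 * card S + 6 * (card Y - card S)"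
    using \<open>S \<subseteq> Y\<close> \<open>finite Y\<close> by (simp add: card_Diff_subset finite_subset)
  finally have sum: "card T = 2 * card S + 6 * (card Y - card S)" .
  have "?h (1 / 3) \<in> Y" using third_T by (simp add: Y_def)
  then have "S = (if 0 \<in> Y then {?h (1 / 3), 0} else {?h (1 / 3)})" by (auto simp: S_def)
  then have "card S = (if 0 \<in> Y then 2 else 1)" using zero_ne by simp
  moreover have "card S \<le> card Y" using \<open>S \<subseteq> Y\<close> \<open>finite Y\<close> by (rule card_mono[rotated])
  ultimately have "6 * card Y = card T + (if 0 \<in> Y then 8 else 4)"
    using sum by (auto split: if_splits)
  then show ?thesis using card_T by (simp add: Y_def split: if_splits)
qed

text \<open>
  The \<open>q - 2\<close> ratios split into \<open>(q - 3) / 2\<close> squares and \<open>(q - 1) / 2\<close> nonsquares. Each nonsquare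
  accounts for a j-invariant of its own, and the squares for the values of \<open>j_of_root\<close>.
\<close>

lemma card_j_of_ratio_image:
  assumes two: "(2::'q::{finite, field}) \<noteq> 0" and three: "(3::'q) \<noteq> 0"
  defines "R \<equiv> {c :: 'q. c \<noteq> 0 \<and> 4 * c \<noteq> 1}" and "T \<equiv> {t :: 'q. t \<noteq> 0 \<and> t\<^sup>2 \<noteq> 1}"
  shows "2 * card (j_of_ratio ` R) + 1 = CARD('q) + 2 * card (j_of_root ` T)"
proof -
  note nz = numeral_3_smooth_nonzero[OF two three]
  note double = neq_uminus_self[OF two]
  let ?sq = "\<lambda>t :: 'q. t\<^sup>2 / 4"
  define S where "S = ?sq ` T"
  define N where "N = R - S"
  have "4 * ?sq t = t\<^sup>2" "?sq t = 0 \<longleftrightarrow> t = 0" for t using nz by simp_all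
  then have "?sq t \<in> R \<longleftrightarrow> t \<in> T" for t unfolding R_def T_def mem_Collect_eq by presburger
  then have S: "S = {c \<in> R. \<exists>t. c = ?sq t}" unfolding S_def by blast
  have "- R = {0, 1 / 4}" unfolding R_def using nz by (auto simp: field_simps)
  then have "card (- R) = 2" using nz by simp
  moreover have "card (- R) = CARD('q) - card R" "card R \<le> CARD('q)"
    by (simp_all add: Compl_eq_Diff_UNIV card_Diff_subset card_mono)
  ultimately have card_R: "card R + 2 = CARD('q)" by simp
  have card_T: "card T + 3 = CARD('q)" unfolding T_def by (rule card_root_params[OF two])
  have "card {x \<in> T. ?sq x = y} = 2" if y: "y \<in> ?sq ` T" for y
  proof -
    obtain t where t: "t \<in> T" "y = ?sq t" using y by blast
    then have eq: "{x \<in> T. ?sq x = y} = {t, - t}"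
      using nz by (auto simp: T_def power2_eq_iff)
    show ?thesis unfolding eq using double[of t] t by (simp add: T_def)
  qed
  then have "card T = 2 * card S"
    unfolding S_def using card_eq_sum_card_fibres[of T ?sq] by simp
  moreover have "S \<subseteq> R" using S by blast
  then have "card N = card R - card S" "card S \<le> card R"
    unfolding N_def by (simp_all add: card_Diff_subset card_mono)
  ultimately have card_N: "2 * card N + 1 = CARD('q)" using card_R card_T by simp
  have nonsquare: "x = c" if "c \<in> N" "x \<in> R" "j_of_ratio x = j_of_ratio c" for c x
    by (rule j_of_ratio_eq_nonsquare[OF two three])
      (use that S in \<open>auto simp: N_def R_def\<close>)
  have "j_of_ratio ` S = j_of_root ` T"
    unfolding S_def image_image using nz by (simp add: j_of_ratio_square)
  moreover have "j_of_ratio ` R = j_of_ratio ` N \<union> j_of_ratio ` S"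
    using \<open>S \<subseteq> R\<close> by (auto simp: N_def)
  moreover have "j_of_ratio ` N \<inter> j_of_ratio ` S = {}"
  proof -
    have "j_of_ratio x \<noteq> j_of_ratio c" if "c \<in> N" "x \<in> S" for c x
      using nonsquare[OF that(1), of x] that \<open>S \<subseteq> R\<close> by (auto simp: N_def)
    then show ?thesis by (auto simp: image_iff; metis)
  qed
  moreover have "inj_on j_of_ratio N"
    by (rule inj_onI) (use nonsquare in \<open>auto simp: N_def\<close>)
  ultimately have "card (j_of_ratio ` R) = card N + card (j_of_root ` T)"
    by (simp add: card_Un_disjoint card_image)
  then show ?thesis using card_N by simp
qed

theorem theorem4p6:
  assumes "CHAR('q::{finite, field}) > 3"
  shows "([CARD('q) = 1] (mod 12) \<or> [CARD('q) = 7] (mod 12) \<longrightarrow>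
            real (card (jacobi_classes :: ('q \<times> 'q) set set)) = (4 * real CARD('q) + 2) / 6) \<and>
         ([CARD('q) = 5] (mod 12) \<or> [CARD('q) = 11] (mod 12) \<longrightarrow>
            real (card (jacobi_classes :: ('q \<times> 'q) set set)) = (4 * real CARD('q) - 2) / 6)"
proof -
  have "(of_nat n :: 'q) \<noteq> 0" if "0 < n" "n \<le> 3" for n
    using assms that unfolding of_nat_eq_0_iff_char_dvd by (auto dest: dvd_imp_le)
  from this[of 2] this[of 3] have two: "(2::'q) \<noteq> 0" and three: "(3::'q) \<noteq> 0" by simp_all
  let ?N = "card (jacobi_classes :: ('q \<times> 'q) set set)"
  let ?n = "card (j_of_root ` {t :: 'q. t \<noteq> 0 \<and> t\<^sup>2 \<noteq> 1})"
  have N: "2 * ?N + 1 = CARD('q) + 2 * ?n"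
    unfolding card_jacobi_classes[OF two three] jacobi_j_image[OF two three]
    by (rule card_j_of_ratio_image[OF two three])
  have n: "6 * ?n = CARD('q) + 5 \<or> 6 * ?n = CARD('q) + 1"
    using card_j_of_root_image[OF two three] by (auto split: if_splits)
  have mod_6: "[k = 1] (mod 12) \<or> [k = 7] (mod 12) \<Longrightarrow> k mod 6 = 1"
    "[k = 5] (mod 12) \<or> [k = 11] (mod 12) \<Longrightarrow> k mod 6 = 5" for k :: nat
    using mod_mod_cancel[of 6 12 k] by (auto simp: cong_def)
  \<comment> \<open>Divisibility by \<open>6\<close> decides whether \<open>j = 0\<close> occurs among the square ratios, that is, whether
    \<open>- 3\<close> is a square in the field.\<close>
  have exact: "6 * m = k + 5" if "6 * m = k + 5 \<or> 6 * m = k + 1" "k mod 6 = 1" for k m :: nat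
    using that by presburger
  have exact': "6 * m = k + 1" if "6 * m = k + 5 \<or> 6 * m = k + 1" "k mod 6 = 5" for k m :: nat
    using that by presburger
  show ?thesis
  proof (intro conjI impI)
    assume "[CARD('q) = 1] (mod 12) \<or> [CARD('q) = 7] (mod 12)"
    then have "CARD('q) mod 6 = 1" by (rule mod_6(1))
    with n have "6 * ?n = CARD('q) + 5" by (rule exact)
    then have "6 * ?N = 4 * CARD('q) + 2" using N by simp
    then have "real (6 * ?N) = real (4 * CARD('q) + 2)" by (rule arg_cong)
    then show "real ?N = (4 * real CARD('q) + 2) / 6" by simp
  next
    assume "[CARD('q) = 5] (mod 12) \<or> [CARD('q) = 11] (mod 12)"
    then have "CARD('q) mod 6 = 5" by (rule mod_6(2))
    with n have "6 * ?n = CARD('q) + 1" by (rule exact')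
    then have "6 * ?N + 2 = 4 * CARD('q)" using N by simp
    then have "real (6 * ?N + 2) = real (4 * CARD('q))" by (rule arg_cong)
    then show "real ?N = (4 * real CARD('q) - 2) / 6" by simp
  qed
qed

end
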